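(* The computational problem $\texttt{SHAP}(\texttt{d-DNF},\overrightarrow{\texttt{MARKOV}})$ is in FP. That is, there is an algorithm which, given a disjoint DNF $\Phi$ over $N$ boolean variables, an instance $x\in\{0,1\}^N$, an integer $i\in[N]$ and a Markovian distribution $P\in\overrightarrow{\texttt{MARKOV}}_N$ on $\{0,1\}^N$, computes exactly $\overrightarrow{\mathrm{SHAP}}(\Phi,x,i,P)$ in time polynomial in $|\Phi|$ and $|\Phi|_\#$.
   Context: $[N]=\{1,\dots,N\}$. Disjoint DNF (d-DNF): a formula $\Phi(X_1,\dots,X_N)$ in boolean variables that is a disjunction of clauses, each clause being a conjunction of one or more literals, such that the clauses are mutually exclusive: for every assignment at most one clause evaluates to true. $|\Phi|=N$ is the number of variables of $\Phi$ and $|\Phi|_\#$ its number of clauses. $f_\Phi:\{0,1\}^N\to\{0,1\}$ is the boolean function computed by $\Phi$. $\overrightarrow{\texttt{MARKOV}}_N$: the set of distributions on $\{0,1\}^N$ of the form $P(X_1,\dots,X_N)=P_{init}(X_1)\prod_{j=1}^{N-1}P_j(X_{j+1}\mid X_j)$, where $P_{init}$ is a probability distribution on $\{0,1\}$ and each $P_j$ is a $2\times2$ stochastic matrix; all entries of $P_{init}$ and of the $P_j$ are assumed $>0$. $P$ is given by these parameters. SHAP score: for a model $M$ computing $f_M:\{0,1\}^N\to\mathbb{R}$, $$\overrightarrow{\mathrm{SHAP}}(M,x,i,P)=\sum_{S\subsetneq[N]}\frac{|S|!\,(N-|S|-1)!}{N!}\big[v(S;M,x,P)-v(S\setminus\{i\};M,x,P)\big],$$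 with $v(S;M,x,P)=\mathbb{E}_{X\sim P}[f_M(X)\mid X_S=x_S]$, where $X_S=x_S$ means $X_j=x_j$ for all $j\in S$. FP: a function problem is in FP if it can be computed exactly by an algorithm running in time polynomial in the size of the instance (here measured by $|\Phi|$ and $|\Phi|_\#$). Running time counts elementary operations, including arithmetic operations on real numbers. *)

theory Defs
  imports "HOL-Probability.Probability" "HOL-Computational_Algebra.Polynomial"
begin

section \<open>A real RAM\<close>

text \<open>
  The machine has finitely many named integer arrays and named real arrays (a program mentions only
  finitely many names), indexed by integers; a scalar variable is a one-cell array.  Integers serve
  as counters, flags and addresses and can only be added, subtracted and compared, so after
  \<open>t\<close> steps they have \<open>O(t + log M)\<close> bits, where \<open>M\<close> is the largest integer of the program and the
  input.  Reals can be added, subtracted, multiplied, divided and compared; the only real constants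
  are integers, and there is no conversion from reals to integers (in particular no rounding).
  Every operation and every memory access has cost 1.
\<close>

record state =
  ints :: "string \<Rightarrow> int \<Rightarrow> int"
  reals :: "string \<Rightarrow> int \<Rightarrow> real"

datatype iexp =
    INum int
  | ICell string iexp
  | IAdd iexp iexp
  | ISub iexp iexp

datatype rexp =
    RNum int
  | RCell string iexp
  | RAdd rexp rexp
  | RSub rexp rexp
  | RMul rexp rexp
  | RDiv rexp rexp

datatype bexp =
    IEq iexp iexp
  | ILess iexp iexp
  | REq rexp rexp
  | RLess rexp rexp
  | BNot bexp
  | BAnd bexp bexp

datatype com =
    Skip
  | IAssign string iexp iexp
  | RAssign string iexp rexp
  | Seq com com
  | Cond bexp com com
  | While bexp com

fun ival :: "iexp \<Rightarrow> state \<Rightarrow> int" where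
  "ival (INum n) s = n"
| "ival (ICell a e) s = ints s a (ival e s)"
| "ival (IAdd e1 e2) s = ival e1 s + ival e2 s"
| "ival (ISub e1 e2) s = ival e1 s - ival e2 s"

text \<open>Division by zero yields 0; as a program can test its divisor, this adds no power.\<close>

fun rval :: "rexp \<Rightarrow> state \<Rightarrow> real" where
  "rval (RNum n) s = of_int n"
| "rval (RCell a e) s = reals s a (ival e s)"
| "rval (RAdd e1 e2) s = rval e1 s + rval e2 s"
| "rval (RSub e1 e2) s = rval e1 s - rval e2 s"
| "rval (RMul e1 e2) s = rval e1 s * rval e2 s"
| "rval (RDiv e1 e2) s = rval e1 s / rval e2 s"

fun bval :: "bexp \<Rightarrow> state \<Rightarrow> bool" where
  "bval (IEq e1 e2) s \<longleftrightarrow> ival e1 s = ival e2 s"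
| "bval (ILess e1 e2) s \<longleftrightarrow> ival e1 s < ival e2 s"
| "bval (REq e1 e2) s \<longleftrightarrow> rval e1 s = rval e2 s"
| "bval (RLess e1 e2) s \<longleftrightarrow> rval e1 s < rval e2 s"
| "bval (BNot b) s \<longleftrightarrow> \<not> bval b s"
| "bval (BAnd b1 b2) s \<longleftrightarrow> bval b1 s \<and> bval b2 s"

fun icost :: "iexp \<Rightarrow> nat" where
  "icost (INum n) = 1"
| "icost (ICell a e) = 1 + icost e"
| "icost (IAdd e1 e2) = 1 + icost e1 + icost e2"
| "icost (ISub e1 e2) = 1 + icost e1 + icost e2"

fun rcost :: "rexp \<Rightarrow> nat" where
  "rcost (RNum n) = 1"
| "rcost (RCell a e) = 1 + icost e"
| "rcost (RAdd e1 e2) = 1 + rcost e1 + rcost e2"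
| "rcost (RSub e1 e2) = 1 + rcost e1 + rcost e2"
| "rcost (RMul e1 e2) = 1 + rcost e1 + rcost e2"
| "rcost (RDiv e1 e2) = 1 + rcost e1 + rcost e2"

fun bcost :: "bexp \<Rightarrow> nat" where
  "bcost (IEq e1 e2) = 1 + icost e1 + icost e2"
| "bcost (ILess e1 e2) = 1 + icost e1 + icost e2"
| "bcost (REq e1 e2) = 1 + rcost e1 + rcost e2"
| "bcost (RLess e1 e2) = 1 + rcost e1 + rcost e2"
| "bcost (BNot b) = 1 + bcost b"
| "bcost (BAnd b1 b2) = 1 + bcost b1 + bcost b2"

definition set_int :: "string \<Rightarrow> int \<Rightarrow> int \<Rightarrow> state \<Rightarrow> state" where
  "set_int a k n s = s\<lparr>ints := (ints s)(a := (ints s a)(k := n))\<rparr>"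

definition set_real :: "string \<Rightarrow> int \<Rightarrow> real \<Rightarrow> state \<Rightarrow> state" where
  "set_real a k r s = s\<lparr>reals := (reals s)(a := (reals s a)(k := r))\<rparr>"

text \<open>\<open>exec c s t s'\<close>: started in \<open>s\<close>, the program \<open>c\<close> halts in \<open>s'\<close> after \<open>t\<close> elementary operations.\<close>

inductive exec :: "com \<Rightarrow> state \<Rightarrow> nat \<Rightarrow> state \<Rightarrow> bool" where
  Skip: "exec Skip s 1 s"
| IAssign: "exec (IAssign a e1 e2) s (1 + icost e1 + icost e2) (set_int a (ival e1 s) (ival e2 s) s)"
| RAssign: "exec (RAssign a e1 e2) s (1 + icost e1 + rcost e2) (set_real a (ival e1 s) (rval e2 s) s)"
| Seq: "exec c1 s1 t1 s2 \<Longrightarrow> exec c2 s2 t2 s3 \<Longrightarrow> exec (Seq c1 c2) s1 (t1 + t2) s3"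
| CondTrue: "bval b s \<Longrightarrow> exec c1 s t s' \<Longrightarrow> exec (Cond b c1 c2) s (1 + bcost b + t) s'"
| CondFalse: "\<not> bval b s \<Longrightarrow> exec c2 s t s' \<Longrightarrow> exec (Cond b c1 c2) s (1 + bcost b + t) s'"
| WhileFalse: "\<not> bval b s \<Longrightarrow> exec (While b c) s (1 + bcost b) s"
| WhileTrue: "bval b s1 \<Longrightarrow> exec c s1 t1 s2 \<Longrightarrow> exec (While b c) s2 t2 s3 \<Longrightarrow>
    exec (While b c) s1 (1 + bcost b + t1 + t2) s3"

inductive_cases exec_SkipE: "exec Skip s t s'"
inductive_cases exec_IAssignE: "exec (IAssign a e1 e2) s t s'"
inductive_cases exec_RAssignE: "exec (RAssign a e1 e2) s t s'"
inductive_cases exec_SeqE: "exec (Seq c1 c2) s t s'"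
inductive_cases exec_CondE: "exec (Cond b c1 c2) s t s'"
inductive_cases exec_WhileE: "exec (While b c) s t s'"

lemma exec_deterministic: "exec c s t s' \<Longrightarrow> exec c s u s'' \<Longrightarrow> u = t \<and> s'' = s'"
proof (induction arbitrary: u s'' rule: exec.induct)
  case (Skip s)
  then show ?case by (auto elim: exec_SkipE)
next
  case (IAssign a e1 e2 s)
  then show ?case by (auto elim: exec_IAssignE)
next
  case (RAssign a e1 e2 s)
  then show ?case by (auto elim: exec_RAssignE)
next
  case (Seq c1 s1 t1 s2 c2 t2 s3)
  from Seq.prems obtain u1 u2 r where u: "u = u1 + u2" "exec c1 s1 u1 r" "exec c2 r u2 s''"
    by (rule exec_SeqE)
  with Seq.IH(1)[OF u(2)] Seq.IH(2)[of u2 s''] show ?case by simp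
next
  case (CondTrue b s c1 t s' c2)
  from CondTrue.prems show ?case
  proof (rule exec_CondE)
    fix v assume "u = Suc (bcost b + v)" "bval b s" "exec c1 s v s''"
    with CondTrue.IH[of v s''] CondTrue.hyps show ?thesis by simp
  next
    fix v assume "u = Suc (bcost b + v)" "\<not> bval b s" "exec c2 s v s''"
    with CondTrue.hyps show ?thesis by simp
  qed
next
  case (CondFalse b s c2 t s' c1)
  from CondFalse.prems show ?case
  proof (rule exec_CondE)
    fix v assume "u = Suc (bcost b + v)" "bval b s" "exec c1 s v s''"
    with CondFalse.hyps show ?thesis by simp
  next
    fix v assume "u = Suc (bcost b + v)" "\<not> bval b s" "exec c2 s v s''"
    with CondFalse.IH[of v s''] CondFalse.hyps show ?thesis by simp
  qed
next
  case (WhileFalse b s c)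
  from WhileFalse.prems show ?case
    by (rule exec_WhileE) (use WhileFalse.hyps in simp_all)
next
  case (WhileTrue b s1 c t1 s2 t2 s3)
  from WhileTrue.prems show ?case
  proof (rule exec_WhileE)
    fix u1 r u2
    assume "u = Suc (bcost b + u1 + u2)" "exec c s1 u1 r" "exec (While b c) r u2 s''"
    with WhileTrue.IH(1)[of u1 r] WhileTrue.IH(2)[of u2 s''] show ?thesis by simp
  qed (use WhileTrue.hyps in simp)
qed

text \<open>
  The input is stored from address 0 on in the arrays named \<open>in\<close>, all other cells being 0; the result
  is read off cell 0 of the real array named \<open>out\<close>.
\<close>

definition load :: "int list \<times> real list \<Rightarrow> state" where
  "load io = \<lparr>
     ints = (\<lambda>a k. if a = ''in'' \<and> 0 \<le> k \<and> k < int (length (fst io)) then fst io ! nat k else 0),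
     reals = (\<lambda>a k. if a = ''in'' \<and> 0 \<le> k \<and> k < int (length (snd io)) then snd io ! nat k else 0)\<rparr>"

definition result :: "state \<Rightarrow> real" where
  "result s = reals s ''out'' 0"

text \<open>
  A function problem consists of its (valid) instances, their representation in memory, the measure
  of instance size, and the answer to be computed.
\<close>

record 'a function_problem =
  instances :: "'a set"
  encode :: "'a \<Rightarrow> int list \<times> real list"
  inst_size :: "'a \<Rightarrow> nat"
  answer :: "'a \<Rightarrow> real"

definition FP :: "'a function_problem set" where
  "FP = {Q. \<exists>(c::com) (p::nat poly). \<forall>a \<in> instances Q.
          \<exists>t s. exec c (load (encode Q a)) t s \<and> t \<le> poly p (inst_size Q a)
            \<and> result s = answer Q a}"


section \<open>Disjoint DNF formulas\<close>

text \<open>Variables are numbered \<open>1, \<dots>, N\<close>; assignments are functions of which only the values on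
  \<open>{1..N}\<close> matter.\<close>

datatype lit = PosLit nat | NegLit nat

fun lit_var :: "lit \<Rightarrow> nat" where
  "lit_var (PosLit j) = j"
| "lit_var (NegLit j) = j"

fun lit_true :: "(nat \<Rightarrow> bool) \<Rightarrow> lit \<Rightarrow> bool" where
  "lit_true X (PosLit j) \<longleftrightarrow> X j"
| "lit_true X (NegLit j) \<longleftrightarrow> \<not> X j"

type_synonym clause = "lit list"

record dnf =
  nvars :: nat
  clauses :: "clause list"

definition clause_true :: "(nat \<Rightarrow> bool) \<Rightarrow> clause \<Rightarrow> bool" where
  "clause_true X C \<longleftrightarrow> (\<forall>l \<in> set C. lit_true X l)"

text \<open>Literals are not repeated within a clause: otherwise the length of the formula would not be
  bounded in terms of the numbers of variables and of clauses.\<close>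

definition wf_dnf :: "dnf \<Rightarrow> bool" where
  "wf_dnf \<Phi> \<longleftrightarrow> (\<forall>C \<in> set (clauses \<Phi>). C \<noteq> [] \<and> distinct C \<and> (\<forall>l \<in> set C. lit_var l \<in> {1..nvars \<Phi>}))"

text \<open>Clauses are compared by position, so a satisfiable clause cannot be listed twice.\<close>

definition disjoint_dnf :: "dnf \<Rightarrow> bool" where
  "disjoint_dnf \<Phi> \<longleftrightarrow> wf_dnf \<Phi> \<and>
     (\<forall>X. \<forall>k < length (clauses \<Phi>). \<forall>l < length (clauses \<Phi>).
        clause_true X (clauses \<Phi> ! k) \<and> clause_true X (clauses \<Phi> ! l) \<longrightarrow> k = l)"

definition dnf_fun :: "dnf \<Rightarrow> (nat \<Rightarrow> bool) \<Rightarrow> real" where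
  "dnf_fun \<Phi> X = of_bool (\<exists>C \<in> set (clauses \<Phi>). clause_true X C)"


section \<open>Markovian distributions\<close>

text \<open>\<open>transition M j a b\<close> is the transition probability \<open>P\<^sub>j(X\<^sub>j\<^sub>+\<^sub>1 = b | X\<^sub>j = a)\<close>.\<close>

record markov =
  init :: "bool \<Rightarrow> real"
  transition :: "nat \<Rightarrow> bool \<Rightarrow> bool \<Rightarrow> real"

definition wf_markov :: "nat \<Rightarrow> markov \<Rightarrow> bool" where
  "wf_markov N M \<longleftrightarrow>
     (\<forall>b. init M b > 0) \<and> (\<Sum>b\<in>UNIV. init M b) = 1 \<and>
     (\<forall>j \<in> {1..<N}. \<forall>a. (\<forall>b. transition M j a b > 0) \<and> (\<Sum>b\<in>UNIV. transition M j a b) = 1)"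

definition cube :: "nat \<Rightarrow> (nat \<Rightarrow> bool) set" where
  "cube N = {1..N} \<rightarrow>\<^sub>E UNIV"

definition markov_weight :: "nat \<Rightarrow> markov \<Rightarrow> (nat \<Rightarrow> bool) \<Rightarrow> real" where
  "markov_weight N M X = init M (X 1) * (\<Prod>j = 1..<N. transition M j (X j) (X (j + 1)))"

definition markov_pmf :: "nat \<Rightarrow> markov \<Rightarrow> (nat \<Rightarrow> bool) pmf" where
  "markov_pmf N M = embed_pmf (\<lambda>X. if X \<in> cube N then markov_weight N M X else 0)"

lemma finite_cube [simp]: "finite (cube N)"
  unfolding cube_def by (rule finite_PiE) auto

lemma cube_Suc: "cube (Suc N) = (\<lambda>(b, X). X(Suc N := b)) ` (UNIV \<times> cube N)"
proof -
  have "{1..Suc N} = insert (Suc N) {1..N}" by auto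
  then show ?thesis unfolding cube_def by (simp only: PiE_insert_eq)
qed

lemma inj_cube_Suc: "inj_on (\<lambda>(b, X). X(Suc N := b)) (UNIV \<times> cube N)"
proof (rule inj_onI, clarify)
  fix b b' and X Y :: "nat \<Rightarrow> bool"
  assume X: "X \<in> cube N" and Y: "Y \<in> cube N" and eq: "X(Suc N := b) = Y(Suc N := b')"
  have b: "b = b'" using fun_cong[OF eq, of "Suc N"] by simp
  have "X j = Y j" for j
  proof (cases "j = Suc N")
    case True
    with X Y show ?thesis by (auto simp: cube_def PiE_def extensional_def)
  next
    case False
    with fun_cong[OF eq, of j] show ?thesis by simp
  qed
  with b show "b = b' \<and> X = Y" by auto
qed

lemma sum_markov_weight:
  assumes "wf_markov N M" "N \<ge> 1"
  shows "(\<Sum>X \<in> cube N. markov_weight N M X) = 1"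
  using assms(2,1)
proof (induction N rule: dec_induct)
  case base
  have "(\<Sum>X \<in> cube (Suc 0). markov_weight (Suc 0) M X) = (\<Sum>(b, X) \<in> UNIV \<times> cube 0. init M b)"
    unfolding cube_Suc
    by (subst sum.reindex[OF inj_cube_Suc]) (auto simp: markov_weight_def intro!: sum.cong)
  also have "\<dots> = (\<Sum>b\<in>UNIV. init M b)"
    by (simp add: sum.cartesian_product[symmetric] cube_def)
  finally show ?case using base by (simp add: wf_markov_def)
next
  case (step n)
  have wt: "markov_weight (Suc n) M (X(Suc n := b)) = markov_weight n M X * transition M n (X n) b" for X b
    using step(1) by (simp add: markov_weight_def)
  have "(\<Sum>X \<in> cube (Suc n). markov_weight (Suc n) M X)
      = (\<Sum>(b, X) \<in> UNIV \<times> cube n. markov_weight n M X * transition M n (X n) b)"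
    unfolding cube_Suc
    by (subst sum.reindex[OF inj_cube_Suc]) (auto simp: wt intro!: sum.cong)
  also have "\<dots> = (\<Sum>b\<in>UNIV. \<Sum>X\<in>cube n. markov_weight n M X * transition M n (X n) b)"
    by (simp only: sum.cartesian_product)
  also have "\<dots> = (\<Sum>X\<in>cube n. markov_weight n M X * (\<Sum>b\<in>UNIV. transition M n (X n) b))"
    by (subst sum.swap) (simp only: sum_distrib_left)
  also have "\<dots> = (\<Sum>X\<in>cube n. markov_weight n M X)"
    using step by (simp add: wf_markov_def)
  also have "\<dots> = 1"
    using step by (auto simp: wf_markov_def)
  finally show ?case .
qed

lemma markov_weight_pos:
  assumes "wf_markov N M"
  shows "markov_weight N M X > 0"
  using assms unfolding markov_weight_def wf_markov_def
  by (intro mult_pos_pos prod_pos) auto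

lemma pmf_markov_pmf:
  assumes "wf_markov N M" "N \<ge> 1"
  shows "pmf (markov_pmf N M) X = (if X \<in> cube N then markov_weight N M X else 0)"
  unfolding markov_pmf_def
proof (rule pmf_embed_pmf)
  let ?f = "\<lambda>X. if X \<in> cube N then markov_weight N M X else 0"
  show nonneg: "0 \<le> ?f x" for x
    using markov_weight_pos[OF assms(1)] by (simp add: less_imp_le)
  have "(\<integral>\<^sup>+ x. ennreal (?f x) \<partial>count_space UNIV) = (\<Sum>x\<in>cube N. ennreal (?f x))"
    by (rule nn_integral_count_space') auto
  also have "\<dots> = ennreal (\<Sum>x\<in>cube N. ?f x)"
    by (rule sum_ennreal) (rule nonneg)
  also have "\<dots> = 1"
    using sum_markov_weight[OF assms] by simp
  finally show "(\<integral>\<^sup>+ x. ennreal (?f x) \<partial>count_space UNIV) = 1" .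
qed


section \<open>SHAP scores\<close>

definition cond_value ::
  "((nat \<Rightarrow> bool) \<Rightarrow> real) \<Rightarrow> (nat \<Rightarrow> bool) \<Rightarrow> (nat \<Rightarrow> bool) pmf \<Rightarrow> nat set \<Rightarrow> real" where
  "cond_value f x P S = measure_pmf.expectation (cond_pmf P {X. \<forall>j\<in>S. X j = x j}) f"

text \<open>Summands with \<open>i \<notin> S\<close> vanish.  Note that the weights and the range of \<open>S\<close> differ from the usual
  form of the Shapley value, which pairs the weight \<open>|S|! (N - |S| - 1)! / N!\<close> with
  \<open>v (S \<union> {i}) - v S\<close> for \<open>i \<notin> S\<close>.\<close>

definition SHAP ::
  "nat \<Rightarrow> ((nat \<Rightarrow> bool) \<Rightarrow> real) \<Rightarrow> (nat \<Rightarrow> bool) \<Rightarrow> nat \<Rightarrow> (nat \<Rightarrow> bool) pmf \<Rightarrow> real" where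
  "SHAP N f x i P = (\<Sum>S | S \<subset> {1..N}.
     fact (card S) * fact (N - card S - 1) / fact N *
       (cond_value f x P S - cond_value f x P (S - {i})))"


section \<open>The computational problem\<close>

record shap_instance =
  formula :: dnf
  point :: "nat \<Rightarrow> bool"
  index :: nat
  distr :: markov

text \<open>Clauses are written as in the DIMACS format: signed variable numbers, terminated by 0.\<close>

fun enc_lit :: "lit \<Rightarrow> int" where
  "enc_lit (PosLit j) = int j"
| "enc_lit (NegLit j) = - int j"

definition enc_clause :: "clause \<Rightarrow> int list" where
  "enc_clause C = map enc_lit C @ [0]"

definition enc_shap :: "shap_instance \<Rightarrow> int list \<times> real list" where
  "enc_shap a = (let \<Phi> = formula a; N = nvars \<Phi>; M = distr a in
     ([int N, int (length (clauses \<Phi>)), int (index a)]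
        @ map (\<lambda>j. of_bool (point a j)) [1..<N + 1]
        @ concat (map enc_clause (clauses \<Phi>)),
      [init M False, init M True]
        @ concat (map (\<lambda>j. [transition M j False False, transition M j False True,
                            transition M j True False, transition M j True True]) [1..<N])))"

definition SHAP_dDNF_MARKOV :: "shap_instance function_problem" where
  "SHAP_dDNF_MARKOV = \<lparr>
     instances = {a. disjoint_dnf (formula a) \<and> index a \<in> {1..nvars (formula a)}
                     \<and> wf_markov (nvars (formula a)) (distr a)},
     encode = enc_shap,
     inst_size = (\<lambda>a. nvars (formula a) + length (clauses (formula a))),
     answer = (\<lambda>a. SHAP (nvars (formula a)) (dnf_fun (formula a)) (point a) (index a)
                     (markov_pmf (nvars (formula a)) (distr a)))\<rparr>"

end

theory Submission
  imports Defs
begin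

text \<open>
  Clauses are disjoint, so the score is a sum over clauses.  For one clause and a set
  \<open>S = {s\<^sub>1 < \<dots> < s\<^sub>k}\<close>, the Markov property factorises the conditional probability of the clause given
  \<open>X\<^sub>S = x\<^sub>S\<close> into a product over consecutive elements \<open>s < e\<close> of \<open>{0} \<union> S \<union> {N + 1}\<close>, where 0 and
  \<open>N + 1\<close> are virtual positions; each factor is a quotient of two products of \<open>2 \<times> 2\<close> matrices.  Hence
  the sum over all \<open>S\<close> of a given size is a sum over the paths from 0 to \<open>N + 1\<close> with a given number
  of edges, computed by dynamic programming, and the same holds for the sets \<open>S\<close> that avoid \<open>i\<close>.
  These two families of sums determine the score.
\<close>

section \<open>Running time and frames of programs\<close>

text \<open>The obstacle is the denominator: the conditional value is a quotient of two masses that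
  both depend on \<open>S\<close>, so a position-by-position sum over \<open>S\<close> cannot treat
  numerator and denominator separately. It helps that the conditioned values are prescribed by
  \<open>x\<close>. At a conditioned position the forward vector collapses to a multiple of a unit
  vector, so numerator and denominator split into scalars at the same places, and each quotient
  belongs to a single gap. Gaps rather than positions are therefore the steps of the recursion. The
  virtual ends turn the initial distribution and the final summation into ordinary transitions, so
  the outer gaps need no special case. Two families suffice because the sets containing
  \<open>i\<close> are obtained by subtraction, and deleting \<open>i\<close> from them gives the
  sets of size one smaller that avoid \<open>i\<close>, still taken with the weight of the larger
  size.\<close>

fun cost :: "com \<Rightarrow> nat poly" where
  "cost Skip = 1"
| "cost (IAssign a e1 e2) = [:1 + icost e1 + icost e2:]"
| "cost (RAssign a e1 e2) = [:1 + icost e1 + rcost e2:]"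
| "cost (Seq c1 c2) = cost c1 + cost c2"
| "cost (Cond b c1 c2) = [:1 + bcost b:] + cost c1 + cost c2"
| "cost (While b c) = [:1, 1:] * ([:1 + bcost b:] + cost c)"

fun int_writes :: "com \<Rightarrow> string set" where
  "int_writes Skip = {}"
| "int_writes (IAssign a e1 e2) = {a}"
| "int_writes (RAssign a e1 e2) = {}"
| "int_writes (Seq c1 c2) = int_writes c1 \<union> int_writes c2"
| "int_writes (Cond b c1 c2) = int_writes c1 \<union> int_writes c2"
| "int_writes (While b c) = int_writes c"

fun real_writes :: "com \<Rightarrow> string set" where
  "real_writes Skip = {}"
| "real_writes (IAssign a e1 e2) = {}"
| "real_writes (RAssign a e1 e2) = {a}"
| "real_writes (Seq c1 c2) = real_writes c1 \<union> real_writes c2"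
| "real_writes (Cond b c1 c2) = real_writes c1 \<union> real_writes c2"
| "real_writes (While b c) = real_writes c"

definition keeps :: "com \<Rightarrow> state \<Rightarrow> state \<Rightarrow> bool" where
  "keeps c s s' \<longleftrightarrow> (\<forall>a. a \<notin> int_writes c \<longrightarrow> ints s' a = ints s a) \<and>
                  (\<forall>a. a \<notin> real_writes c \<longrightarrow> reals s' a = reals s a)"

lemma keeps_refl [simp]: "keeps c s s"
  by (simp add: keeps_def)

lemma keeps_trans: "keeps c s1 s2 \<Longrightarrow> keeps c s2 s3 \<Longrightarrow> keeps c s1 s3"
  by (simp add: keeps_def)

lemma ints_set_int [simp]: "ints (set_int a k v s) b = (if b = a then (ints s a)(k := v) else ints s b)"
  by (simp add: set_int_def)

lemma reals_set_int [simp]: "reals (set_int a k v s) = reals s"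
  by (simp add: set_int_def)

lemma ints_set_real [simp]: "ints (set_real a k v s) = ints s"
  by (simp add: set_real_def)

lemma reals_set_real [simp]:
  "reals (set_real a k v s) b = (if b = a then (reals s a)(k := v) else reals s b)"
  by (simp add: set_real_def)

lemma exec_keeps: "exec c s t s' \<Longrightarrow> keeps c s s'"
  by (induction rule: exec.induct) (auto simp: keeps_def)

text \<open>The parameter \<open>n\<close> bounds the number of iterations of every single loop execution, so
  that the running time is a polynomial in \<open>n\<close> determined by the program text.\<close>

definition runs :: "nat \<Rightarrow> com \<Rightarrow> state \<Rightarrow> (state \<Rightarrow> bool) \<Rightarrow> bool" where
  "runs n c s Q \<longleftrightarrow> (\<exists>t s'. exec c s t s' \<and> t \<le> poly (cost c) n \<and> Q s')"

text \<open>The frame condition comes for free from the syntactic write sets, so postconditions need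
  to mention only the arrays that a program changes.\<close>

lemma runs_mono:
  "runs n c s Q \<Longrightarrow> (\<And>s'. keeps c s s' \<Longrightarrow> Q s' \<Longrightarrow> Q' s') \<Longrightarrow> runs n c s Q'"
  unfolding runs_def using exec_keeps by blast

lemma runs_IAssign [simp]:
  "runs n (IAssign a e1 e2) s Q \<longleftrightarrow> Q (set_int a (ival e1 s) (ival e2 s) s)"
  unfolding runs_def
  using exec.IAssign[of a e1 e2 s] by (fastforce elim: exec_IAssignE)

lemma runs_RAssign [simp]:
  "runs n (RAssign a e1 e2) s Q \<longleftrightarrow> Q (set_real a (ival e1 s) (rval e2 s) s)"
  unfolding runs_def
  using exec.RAssign[of a e1 e2 s] by (fastforce elim: exec_RAssignE)

lemma runs_Seq: "runs n c1 s (\<lambda>s'. runs n c2 s' Q) \<Longrightarrow> runs n (Seq c1 c2) s Q"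
  unfolding runs_def by (fastforce intro: exec.Seq add_mono)

lemma runs_Cond:
  "(bval b s \<Longrightarrow> runs n c1 s Q) \<Longrightarrow> (\<not> bval b s \<Longrightarrow> runs n c2 s Q) \<Longrightarrow> runs n (Cond b c1 c2) s Q"
proof (cases "bval b s")
  case True
  assume "bval b s \<Longrightarrow> runs n c1 s Q"
  then obtain t s' where *: "exec c1 s t s'" "t \<le> poly (cost c1) n" "Q s'"
    using True unfolding runs_def by blast
  show ?thesis unfolding runs_def
    by (rule exI, rule exI, rule conjI, rule exec.CondTrue[OF True *(1)]) (use * in simp)
next
  case False
  assume "\<not> bval b s \<Longrightarrow> runs n c2 s Q"
  then obtain t s' where *: "exec c2 s t s'" "t \<le> poly (cost c2) n" "Q s'"
    using False unfolding runs_def by blast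
  show ?thesis unfolding runs_def
    by (rule exI, rule exI, rule conjI, rule exec.CondFalse[OF False *(1)]) (use * in simp)
qed

text \<open>The invariant counts completed iterations, so correctness and termination are proved
  together. With at most \<open>n\<close> iterations the test is evaluated at most
  \<open>n + 1\<close> times, whence the factor \<open>[:1, 1:]\<close> in
  \<open>cost\<close>.\<close>

lemma runs_While:
  assumes "I 0 s" and "K \<le> n"
    and body: "\<And>k s'. k < K \<Longrightarrow> keeps c s s' \<Longrightarrow> I k s' \<Longrightarrow> bval b s' \<and> runs n c s' (I (Suc k))"
    and exit: "\<And>s'. keeps c s s' \<Longrightarrow> I K s' \<Longrightarrow> \<not> bval b s' \<and> Q s'"
  shows "runs n (While b c) s Q"
proof -
  let ?T = "1 + bcost b + poly (cost c) n"
  \<comment> \<open>Here \<open>m\<close> iterations remain; the final failing test is charged as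
    much as a full iteration.\<close>
  have "\<exists>t s'. exec (While b c) r t s' \<and> t \<le> Suc m * ?T \<and> Q s'"
    if "m + k = K" "I k r" "keeps c s r" for m k r
    using that
  proof (induction m arbitrary: k r)
    case 0
    then have "\<not> bval b r" "Q r" using exit by auto
    then show ?case using exec.WhileFalse[of b r c] by fastforce
  next
    case (Suc m)
    then have b: "bval b r" and "runs n c r (I (Suc k))" using body[of k r] by auto
    then obtain t1 r' where 1: "exec c r t1 r'" "t1 \<le> poly (cost c) n" "I (Suc k) r'"
      unfolding runs_def by blast
    moreover have "keeps c s r'" using Suc.prems(3) exec_keeps[OF 1(1)] by (rule keeps_trans)
    ultimately obtain t2 s' where 2: "exec (While b c) r' t2 s'" "t2 \<le> Suc m * ?T" "Q s'"
      using Suc.IH[of "Suc k" r'] Suc.prems by auto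
    have "1 + bcost b + t1 + t2 \<le> Suc (Suc m) * ?T" using 1 2 by simp
    with exec.WhileTrue[OF b 1(1) 2(1)] 2(3) show ?case by blast
  qed
  from this[of K 0 s] assms(1) obtain t s' where
    "exec (While b c) s t s'" "t \<le> Suc K * ?T" "Q s'" by auto
  moreover have "Suc K * ?T \<le> Suc n * ?T" using assms(2) by (intro mult_right_mono) auto
  ultimately show ?thesis unfolding runs_def by (intro exI[of _ t] exI[of _ s']) simp
qed

fun block :: "com list \<Rightarrow> com" where
  "block [] = Skip"
| "block [c] = c"
| "block (c # cs) = Seq c (block cs)"

abbreviation (input) ivar :: "string \<Rightarrow> iexp" where "ivar a \<equiv> ICell a (INum 0)"
abbreviation (input) rvar :: "string \<Rightarrow> rexp" where "rvar a \<equiv> RCell a (INum 0)"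
abbreviation (input) iset :: "string \<Rightarrow> iexp \<Rightarrow> com" where "iset a \<equiv> IAssign a (INum 0)"
abbreviation (input) rset :: "string \<Rightarrow> rexp \<Rightarrow> com" where "rset a \<equiv> RAssign a (INum 0)"

section \<open>Sums over paths\<close>

text \<open>\<open>forward\<close> and \<open>guarded_mass\<close> weigh assignments by a product of factors \<open>g j (X j)\<close>, which is the
  indicator of a clause for \<open>g = clause_guard L\<close>, and constantly 1 for the normalising masses.\<close>

fun forward ::
  "(nat \<Rightarrow> bool) \<Rightarrow> (nat \<Rightarrow> bool \<Rightarrow> bool \<Rightarrow> real) \<Rightarrow> nat set \<Rightarrow> (nat \<Rightarrow> bool \<Rightarrow> real) \<Rightarrow> nat \<Rightarrow> nat \<Rightarrow> bool \<Rightarrow> real"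
where
  "forward x t S g s 0 b = of_bool (b = x s)"
| "forward x t S g s (Suc d) b =
     of_bool (Suc (s + d) \<in> S \<longrightarrow> b = x (Suc (s + d))) *
     ((\<Sum>a\<in>UNIV. forward x t S g s d a * t (s + d) a b) * g (Suc (s + d)) b)"

text \<open>Conditional probability of the part of the clause strictly after \<open>s\<close> up to \<open>e\<close>, given the
  values at the consecutive conditioned positions \<open>s\<close> and \<open>e\<close>.\<close>

definition ratio ::
  "(nat \<Rightarrow> bool) \<Rightarrow> (nat \<Rightarrow> bool \<Rightarrow> bool \<Rightarrow> real) \<Rightarrow> (nat \<Rightarrow> bool \<Rightarrow> real) \<Rightarrow> nat \<Rightarrow> nat \<Rightarrow> real"
where
  "ratio x t g s e =
     forward x t {} g s (e - s) (x e) / forward x t {} (\<lambda>_ _. 1) s (e - s) (x e)"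

text \<open>Paths from 0 to \<open>e\<close> with \<open>k\<close> edges whose nodes, apart from the start, avoid \<open>E\<close>.  A set \<open>S\<close> of
  size \<open>k\<close> is a path from 0 to \<open>N + 1\<close> with \<open>k + 1\<close> edges.\<close>

fun dp :: "(nat \<Rightarrow> nat \<Rightarrow> real) \<Rightarrow> nat set \<Rightarrow> nat \<Rightarrow> nat \<Rightarrow> real" where
  "dp R E 0 e = of_bool (e = 0)"
| "dp R E (Suc k) e = (if e \<in> E then 0 else \<Sum>s<e. dp R E k s * R s e)"

definition shapley_weight :: "nat \<Rightarrow> nat \<Rightarrow> real" where
  "shapley_weight N k = fact k * fact (N - k - 1) / fact N"

text \<open>The first two path sums differ by the total over the sets of size \<open>k\<close>
  containing \<open>i\<close>; the last is the total over the same sets with \<open>i\<close>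
  removed. These have size \<open>k - 1\<close>, hence \<open>k\<close> edges. For
  \<open>k = 0\<close> the last term is 0, as a path without edges stays at 0.\<close>

definition path_score :: "(nat \<Rightarrow> nat \<Rightarrow> real) \<Rightarrow> nat \<Rightarrow> nat \<Rightarrow> nat \<Rightarrow> real" where
  "path_score R N i k = shapley_weight N k *
     (dp R {} (Suc k) (Suc N) - dp R {i} (Suc k) (Suc N) - dp R {i} k (Suc N))"

text \<open>A value is excluded if it falsifies a literal of the clause. A clause with both literals
  of a variable excludes both values there, so unsatisfiable clauses need no separate
  treatment.\<close>

definition clause_guard :: "int list \<Rightarrow> nat \<Rightarrow> bool \<Rightarrow> real" where
  "clause_guard L j b = of_bool ((if b then - int j else int j) \<notin> set L)"

lemma forward_cong:
  "(\<And>j. s < j \<Longrightarrow> j \<le> s + d \<Longrightarrow> g j = h j \<and> (j \<in> S \<longleftrightarrow> j \<in> S')) \<Longrightarrow>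
   forward x t S g s d b = forward x t S' h s d b"
  by (induction d arbitrary: b) auto

section \<open>Forward vectors as masses of assignments\<close>

definition agree :: "(nat \<Rightarrow> bool) \<Rightarrow> nat set \<Rightarrow> (nat \<Rightarrow> bool) \<Rightarrow> bool" where
  "agree x S X \<longleftrightarrow> (\<forall>j\<in>S. X j = x j)"

definition guarded_mass ::
  "nat \<Rightarrow> markov \<Rightarrow> (nat \<Rightarrow> bool) \<Rightarrow> (nat \<Rightarrow> bool \<Rightarrow> real) \<Rightarrow> nat set \<Rightarrow> real" where
  "guarded_mass N M x g S =
     (\<Sum>X\<in>cube N. of_bool (agree x S X) * (markov_weight N M X * (\<Prod>j=1..N. g j (X j))))"

lemma sum_cube_Suc:
  fixes f :: "(nat \<Rightarrow> bool) \<Rightarrow> real"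
  shows "(\<Sum>X\<in>cube (Suc n). f X) = (\<Sum>X\<in>cube n. f (X(Suc n := False)) + f (X(Suc n := True)))"
proof -
  have "(\<Sum>X\<in>cube (Suc n). f X) = (\<Sum>(b, X)\<in>UNIV \<times> cube n. f (X(Suc n := b)))"
    unfolding cube_Suc by (subst sum.reindex[OF inj_cube_Suc]) (auto intro!: sum.cong)
  also have "\<dots> = (\<Sum>b\<in>UNIV. \<Sum>X\<in>cube n. f (X(Suc n := b)))"
    by (simp only: sum.cartesian_product)
  finally show ?thesis by (simp add: UNIV_bool sum.distrib)
qed

text \<open>The weight is a product of factors linking neighbouring coordinates, so the sum over
  assignments can be built up one coordinate at a time. The row of \<open>t 0\<close> for
  \<open>True\<close> acts as the initial distribution, which is why \<open>x 0\<close> is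
  assumed.\<close>

lemma forward_eq_sum:
  assumes "1 \<le> n" "n \<le> N" and "x 0"
    and t0: "\<And>b. t 0 True b = init M b"
    and t: "\<And>j a b. 1 \<le> j \<Longrightarrow> j < N \<Longrightarrow> t j a b = transition M j a b"
  shows "forward x t S g 0 n b = (\<Sum>X\<in>cube n. of_bool (X n = b \<and> agree x (S \<inter> {1..n}) X) *
           (markov_weight n M X * (\<Prod>j=1..n. g j (X j))))"
  using assms(1,2)
proof (induction n arbitrary: b rule: dec_induct)
  case base
  have "cube 0 = {\<lambda>_. undefined}" by (simp add: cube_def)
  then show ?case using \<open>x 0\<close>
    by (cases b) (auto simp: sum_cube_Suc UNIV_bool agree_def markov_weight_def t0)
next
  case (step n)
  let ?w = "\<lambda>X. markov_weight n M X * (\<Prod>j=1..n. g j (X j))"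
  let ?ok = "of_bool (Suc n \<in> S \<longrightarrow> b = x (Suc n)) :: real"
  have wt: "markov_weight (Suc n) M (X(Suc n := c)) = markov_weight n M X * t n (X n) c" for X c
    using step(1,4) t[of n] by (simp add: markov_weight_def)
  have ag: "agree x (S \<inter> {1..Suc n}) (X(Suc n := c)) \<longleftrightarrow>
      agree x (S \<inter> {1..n}) X \<and> (Suc n \<in> S \<longrightarrow> c = x (Suc n))" for X c
  proof -
    have "{1..Suc n} = insert (Suc n) {1..n}" by auto
    moreover have "(X(Suc n := c)) j = X j" if "j \<in> {1..n}" for j using that by simp
    ultimately show ?thesis unfolding agree_def by (simp only: Int_insert_right) force
  qed
  \<comment> \<open>For each \<open>X\<close> only \<open>a = X n\<close> contributes to the
    inserted sum over \<open>a\<close>. It brings the value at \<open>n\<close> into the indicator,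
    as the induction hypothesis requires.\<close>
  have "(\<Sum>X\<in>cube (Suc n). of_bool (X (Suc n) = b \<and> agree x (S \<inter> {1..Suc n}) X) *
           (markov_weight (Suc n) M X * (\<Prod>j=1..Suc n. g j (X j)))) =
    (\<Sum>X\<in>cube n. ?ok * (\<Sum>a\<in>UNIV. of_bool (X n = a \<and> agree x (S \<inter> {1..n}) X) * ?w X * t n a b) * g (Suc n) b)"
    unfolding sum_cube_Suc wt ag
    by (intro sum.cong refl)
      (simp add: UNIV_bool mult_ac del: sum_of_bool_mult_eq sum_mult_of_bool_eq; auto)
  also have "\<dots> = ?ok * ((\<Sum>a\<in>UNIV. (\<Sum>X\<in>cube n. of_bool (X n = a \<and> agree x (S \<inter> {1..n}) X) * ?w X) * t n a b) * g (Suc n) b)"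
    unfolding sum_distrib_left sum_distrib_right by (subst sum.swap) (simp only: mult_ac)
  finally show ?case using step by simp
qed

text \<open>The last step has transitions and guard 1, so it just sums out the value at
  \<open>N\<close>, with the same result for both values \<open>b\<close> at the virtual
  end.\<close>

lemma forward_Suc_eq_guarded_mass:
  assumes "1 \<le> N" "S \<subseteq> {1..N}" and "x 0"
    and t0: "\<And>b. t 0 True b = init M b"
    and t: "\<And>j a b. 1 \<le> j \<Longrightarrow> j < N \<Longrightarrow> t j a b = transition M j a b"
    and tN: "\<And>a b. t N a b = 1" and gN: "\<And>b. g (Suc N) b = 1"
  shows "forward x t S g 0 (Suc N) b = guarded_mass N M x g S"
proof -
  have "S \<inter> {1..N} = S" "Suc N \<notin> S" using assms(2) by auto
  then have "forward x t S g 0 (Suc N) b = (\<Sum>a\<in>UNIV. \<Sum>X\<in>cube N. of_bool (X N = a \<and> agree x S X) *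
      (markov_weight N M X * (\<Prod>j=1..N. g j (X j))))"
    using forward_eq_sum[OF assms(1) le_refl, of x t M, OF assms(3) t0 t, of S g]
    by (simp add: tN gN del: sum_of_bool_mult_eq sum_mult_of_bool_eq)
  also have "\<dots> = guarded_mass N M x g S"
    unfolding guarded_mass_def sum.swap[of _ _ UNIV] by (intro sum.cong refl) (simp add: UNIV_bool)
  finally show ?thesis .
qed

text \<open>The recursion is linear and does not see \<open>S\<close> between conditioned positions;
  a vector concentrated on \<open>x s\<close> is \<open>c\<close> times the starting vector of a
  fresh recursion at \<open>s\<close>.\<close>

lemma forward_split:
  assumes "\<And>j. s < j \<Longrightarrow> j \<le> s + d \<Longrightarrow> j \<notin> S"
    and "\<And>b. forward x t S g 0 s b = c * of_bool (b = x s)"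
  shows "forward x t S g 0 (s + d) b = c * forward x t {} g s d b"
  using assms
  by (induction d arbitrary: b) (simp_all add: sum_distrib_left sum_distrib_right mult_ac)

lemma forward_insert:
  assumes "1 \<le> s" "S \<subseteq> {1..<s}"
  shows "forward x t (insert s S) g 0 s b = forward x t S g 0 s (x s) * of_bool (b = x s)"
proof -
  obtain r where s: "s = Suc r" using assms(1) by (cases s) auto
  have "forward x t (insert s S) g 0 r a = forward x t S g 0 r a" for a
    by (rule forward_cong) (use s in auto)
  moreover have "Suc r \<notin> S" using assms(2) s by auto
  ultimately show ?thesis by (cases "b = x (Suc r)") (simp_all add: s)
qed

text \<open>With \<open>g\<close> the guard of a clause and \<open>n = N + 1\<close>, this is the
  conditional probability of the clause given the values on \<open>S\<close>. For smaller
  \<open>n\<close> the position \<open>n\<close> is conditioned as well and only constraints up to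
  \<open>n\<close> count, which gives the weight of a path ending in \<open>n\<close>.\<close>

definition path_value ::
  "(nat \<Rightarrow> bool) \<Rightarrow> (nat \<Rightarrow> bool \<Rightarrow> bool \<Rightarrow> real) \<Rightarrow> (nat \<Rightarrow> bool \<Rightarrow> real) \<Rightarrow> nat set \<Rightarrow> nat \<Rightarrow> real" where
  "path_value x t g S n =
     forward x t S g 0 n (x n) / forward x t S (\<lambda>_ _. 1) 0 n (x n)"

text \<open>This is the Markov property: given the value at \<open>s\<close>, past and future are
  independent. Guarded and unguarded vectors are cut at the same position, so the quotient splits
  too.\<close>

lemma path_value_insert:
  assumes "1 \<le> s" "s < n" "S \<subseteq> {1..<s}"
  shows "path_value x t g (insert s S) n = path_value x t g S s * ratio x t g s n"
proof -
  have "forward x t (insert s S) h 0 (s + (n - s)) b = forward x t S h 0 s (x s) * forward x t {} h s (n - s) b"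
    for h b by (rule forward_split) (use assms forward_insert in auto)
  then show ?thesis using assms(2) by (simp add: path_value_def ratio_def)
qed

lemma path_value_empty: "path_value x t g {} n = ratio x t g 0 n"
  by (simp add: path_value_def ratio_def)

text \<open>A nonempty set is determined by its maximum \<open>s\<close>, the last inner node of the
  path, and by its elements below \<open>s\<close>; splitting off \<open>s\<close> splits off the
  factor of the last edge.\<close>

lemma dp_eq_sum:
  assumes "1 \<le> e"
  shows "dp (ratio x t g) E (Suc k) e =
    (if e \<in> E then 0 else \<Sum>S | S \<subseteq> {1..<e} - E \<and> card S = k. path_value x t g S e)"
  using assms
proof (induction k arbitrary: e)
  case 0
  have "{S. S \<subseteq> {1..<e} - E \<and> card S = 0} = {{}}"
    by (auto dest: finite_subset)
  moreover have "(\<Sum>s<e. of_bool (s = 0) * ratio x t g s e) = ratio x t g 0 e"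
    using 0 by (simp add: sum.remove[of _ 0])
  ultimately show ?case by (simp add: path_value_empty)
next
  case (Suc k)
  let ?R = "ratio x t g" and ?P = "\<lambda>k e. {S. S \<subseteq> {1..<e} - E \<and> card S = k}"
  have fin: "finite (?P k s)" for k s by (rule finite_subset[of _ "Pow {1..<s}"]) auto
  \<comment> \<open>Nodes in \<open>E\<close> contribute 0, and so does node 0, whose sum over
    smaller nodes is empty.\<close>
  have "(\<Sum>s<e. dp ?R E (Suc k) s * ?R s e) = (\<Sum>s\<in>{1..<e} - E. dp ?R E (Suc k) s * ?R s e)"
    by (rule sum.mono_neutral_right) (auto simp: Suc_le_eq intro!: gr0I)
  also have "\<dots> = (\<Sum>s\<in>{1..<e} - E. \<Sum>S\<in>?P k s. path_value x t g (insert s S) e)"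
  proof (rule sum.cong[OF refl])
    fix s assume s: "s \<in> {1..<e} - E"
    then have "dp ?R E (Suc k) s = (\<Sum>S\<in>?P k s. path_value x t g S s)"
      using Suc.IH[of s] by (simp del: dp.simps)
    then have "dp ?R E (Suc k) s * ?R s e = (\<Sum>S\<in>?P k s. path_value x t g S s * ?R s e)"
      by (simp only: sum_distrib_right)
    also have "\<dots> = (\<Sum>S\<in>?P k s. path_value x t g (insert s S) e)"
      by (intro sum.cong refl path_value_insert[symmetric]) (use s in auto)
    finally show "dp ?R E (Suc k) s * ?R s e = \<dots>" .
  qed
  also have "\<dots> = (\<Sum>(s, S)\<in>Sigma ({1..<e} - E) (?P k). path_value x t g (insert s S) e)"
    by (rule sum.Sigma) (use fin in auto)
  also have "\<dots> = (\<Sum>S\<in>?P (Suc k) e. path_value x t g S e)"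
  proof (rule sum.reindex_bij_witness[of _ "\<lambda>S. (Max S, S - {Max S})" "\<lambda>(s, S). insert s S"])
    fix p assume p: "p \<in> Sigma ({1..<e} - E) (?P k)"
    obtain s S where ps: "p = (s, S)" by force
    have S: "S \<subseteq> {1..<s} - E" "card S = k" "s \<in> {1..<e} - E" using p ps by auto
    have "finite S" using S(1) finite_subset by blast
    moreover have "s \<notin> S" using S by auto
    moreover have "Max (insert s S) = s" using S(1) \<open>finite S\<close> by (intro Max_eqI) auto
    ultimately show "(Max (case p of (s, S) \<Rightarrow> insert s S), (case p of (s, S) \<Rightarrow> insert s S) - {Max (case p of (s, S) \<Rightarrow> insert s S)}) = p"
      "(case p of (s, S) \<Rightarrow> insert s S) \<in> ?P (Suc k) e"
      using S ps by auto
  next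
    fix S assume "S \<in> ?P (Suc k) e"
    then have S: "S \<subseteq> {1..<e} - E" "card S = Suc k" by auto
    then have "finite S" "S \<noteq> {}" using finite_subset by (blast, auto)
    then have Max: "Max S \<in> S" "\<And>j. j \<in> S \<Longrightarrow> j \<le> Max S" by auto
    have "S - {Max S} \<subseteq> {1..<Max S} - E"
    proof
      fix j assume "j \<in> S - {Max S}"
      then show "j \<in> {1..<Max S} - E" using Max(2)[of j] S(1) by force
    qed
    moreover have "card (S - {Max S}) = k" using S(2) Max(1) by simp
    moreover have "Max S \<in> {1..<e} - E" using S(1) Max(1) by blast
    ultimately show "(Max S, S - {Max S}) \<in> Sigma ({1..<e} - E) (?P k)" by simp
    show "(case (Max S, S - {Max S}) of (s, S) \<Rightarrow> insert s S) = S"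
      using Max(1) by (simp add: insert_absorb)
  qed auto
  finally show ?case by simp
qed

section \<open>SHAP scores as path sums\<close>

text \<open>Positive parameters make every point of the cube possible, so each conditioning event
  has positive mass and \<open>cond_pmf\<close> is the elementary quotient.\<close>

lemma cond_value_markov:
  assumes "wf_markov N M" "N \<ge> 1" "S \<subseteq> {1..N}"
  shows "cond_value f x (markov_pmf N M) S =
    (\<Sum>X\<in>cube N. of_bool (agree x S X) * (markov_weight N M X * f X)) /
    (\<Sum>X\<in>cube N. of_bool (agree x S X) * markov_weight N M X)"
proof -
  let ?p = "markov_pmf N M" and ?A = "{X. agree x S X}"
  note pmf = pmf_markov_pmf[OF assms(1,2)]
  have "markov_weight N M X \<noteq> 0" for X
    using markov_weight_pos[OF assms(1), of X] by simp
  then have set: "set_pmf ?p = cube N"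
    by (auto simp: set_pmf_iff pmf split: if_splits)
  \<comment> \<open>Points of the cube are \<open>undefined\<close> outside \<open>{1..N}\<close>,
    so \<open>x\<close> has to be restricted.\<close>
  have "(\<lambda>j. if j \<in> {1..N} then x j else undefined) \<in> cube N \<inter> ?A"
    using assms(3) by (auto simp: cube_def agree_def PiE_def extensional_def)
  then have ne: "set_pmf ?p \<inter> ?A \<noteq> {}" unfolding set by blast
  have meas: "measure (measure_pmf ?p) ?A = (\<Sum>X\<in>cube N. of_bool (agree x S X) * markov_weight N M X)"
  proof -
    have "measure (measure_pmf ?p) ?A = measure (measure_pmf ?p) (cube N \<inter> ?A)"
      using measure_Int_set_pmf[of ?p ?A] by (simp add: set Int_commute)
    also have "\<dots> = (\<Sum>X\<in>cube N \<inter> ?A. pmf ?p X)" by (rule measure_measure_pmf_finite) simp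
    also have "\<dots> = (\<Sum>X\<in>cube N. of_bool (agree x S X) * markov_weight N M X)"
      by (rule sum.mono_neutral_cong_left) (auto simp: pmf)
    finally show ?thesis .
  qed
  have "cond_value f x ?p S = (\<Sum>X\<in>cube N. f X * pmf (cond_pmf ?p ?A) X)"
    unfolding cond_value_def agree_def[symmetric]
    by (rule integral_measure_pmf_real) (auto simp: set_cond_pmf[OF ne] set)
  also have "\<dots> = (\<Sum>X\<in>cube N. of_bool (agree x S X) * (markov_weight N M X * f X) / measure (measure_pmf ?p) ?A)"
    by (rule sum.cong) (auto simp: pmf_cond[OF ne] pmf)
  also have "\<dots> = (\<Sum>X\<in>cube N. of_bool (agree x S X) * (markov_weight N M X * f X)) / measure (measure_pmf ?p) ?A"
    by (rule sum_divide_distrib[symmetric])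
  finally show ?thesis unfolding meas .
qed

text \<open>In the proof, \<open>?neg j\<close> is the code of the literal on \<open>j\<close> that
  \<open>X\<close> falsifies; a clause is true iff it contains none of these.\<close>

lemma clause_true_eq_prod:
  assumes "\<forall>l\<in>set C. lit_var l \<in> {1..N}"
  shows "of_bool (clause_true X C) = (\<Prod>j=1..N. clause_guard (map enc_lit C) j (X j))"
proof -
  have "clause_true X C \<longleftrightarrow> (\<forall>j\<in>{1..N}. (if X j then - int j else int j) \<notin> enc_lit ` set C)"
  proof -
    let ?neg = "\<lambda>j. if X j then - int j else int j"
    \<comment> \<open>Numbering from 1 matters: the two literals of a variable 0 would share the
      code 0.\<close>
    have true: "lit_true X l \<longleftrightarrow> ?neg (lit_var l) \<noteq> enc_lit l" if "l \<in> set C" for l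
    proof -
      have "lit_var l \<ge> 1" using that assms by auto
      then show ?thesis by (cases l) auto
    qed
    have var: "j = lit_var l" if "?neg j = enc_lit l" "j \<ge> 1" for j l
      using that by (cases l) (auto split: if_splits)
    show ?thesis
    proof
      assume "clause_true X C"
      then have not_neg: "?neg (lit_var l) \<noteq> enc_lit l" if "l \<in> set C" for l
        using that true[OF that] by (simp add: clause_true_def)
      show "\<forall>j\<in>{1..N}. ?neg j \<notin> enc_lit ` set C"
      proof (intro ballI notI)
        fix j assume "j \<in> {1..N}" "?neg j \<in> enc_lit ` set C"
        then obtain l where l: "l \<in> set C" "?neg j = enc_lit l" "j \<ge> 1" by (auto simp only: image_iff atLeastAtMost_iff)
        then show False using not_neg[OF l(1)] var[OF l(2,3)] by blast
      qed
    next
      assume *: "\<forall>j\<in>{1..N}. ?neg j \<notin> enc_lit ` set C"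
      have "lit_true X l" if "l \<in> set C" for l
        using bspec[OF *, of "lit_var l"] that true[OF that] assms by (metis imageI)
      then show "clause_true X C" by (simp add: clause_true_def)
    qed
  qed
  moreover have "(\<Prod>j\<in>J. of_bool (Q j) :: real) = of_bool (\<forall>j\<in>J. Q j)" if "finite J" for J :: "nat set" and Q
    using that by induction auto
  ultimately show ?thesis by (simp add: clause_guard_def)
qed

lemma dnf_fun_eq_sum:
  assumes "disjoint_dnf \<Phi>"
  shows "dnf_fun \<Phi> X = (\<Sum>k<length (clauses \<Phi>). of_bool (clause_true X (clauses \<Phi> ! k)))"
proof (cases "\<exists>C\<in>set (clauses \<Phi>). clause_true X C")
  case True
  then obtain k where k: "k < length (clauses \<Phi>)" "clause_true X (clauses \<Phi> ! k)"
    by (auto simp: in_set_conv_nth)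
  then have "clause_true X (clauses \<Phi> ! l) \<longleftrightarrow> l = k" if "l < length (clauses \<Phi>)" for l
    using assms that unfolding disjoint_dnf_def by blast
  then have "(\<Sum>l<length (clauses \<Phi>). of_bool (clause_true X (clauses \<Phi> ! l))) = (\<Sum>l<length (clauses \<Phi>). of_bool (l = k) :: real)"
    by (intro sum.cong) auto
  also have "\<dots> = 1" using k(1) by (simp add: of_bool_def)
  finally show ?thesis using True by (simp add: dnf_fun_def)
next
  case False
  then show ?thesis by (auto simp: dnf_fun_def)
qed

text \<open>The sets of size \<open>k\<close> containing \<open>i\<close> are all sets of size \<open>k\<close> except those avoiding \<open>i\<close>; removing
  \<open>i\<close> maps them bijectively onto the sets of size \<open>k - 1\<close> avoiding \<open>i\<close>.\<close>

definition layer :: "(nat set \<Rightarrow> real) \<Rightarrow> nat \<Rightarrow> nat set \<Rightarrow> nat \<Rightarrow> real" where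
  "layer v N E k = (\<Sum>S | S \<subseteq> {1..<Suc N} - E \<and> card S = k. v S)"

lemma SHAP_eq_layers:
  assumes "i \<in> {1..N}"
  shows "SHAP N f x i P = (\<Sum>k<N. shapley_weight N k *
    (layer (cond_value f x P) N {} k - layer (cond_value f x P) N {i} k
      - (case k of 0 \<Rightarrow> 0 | Suc l \<Rightarrow> layer (cond_value f x P) N {i} l)))"
proof -
  define v where "v = cond_value f x P"
  define A where "A = (\<lambda>k. {S. S \<subseteq> {1..N} \<and> card S = k})"
  have ivl: "{1..<Suc N} = {1..N}" by auto
  have finA: "finite (A k)" for k unfolding A_def by (rule finite_subset[of _ "Pow {1..N}"]) auto
  have proper: "{S. S \<subset> {1..N}} = (\<Union>k<N. A k)"
  proof -
    have "S \<subset> {1..N} \<longleftrightarrow> S \<subseteq> {1..N} \<and> card S < N" for S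
      using psubset_card_mono[of "{1..N}" S] by (auto simp: psubset_eq)
    then show ?thesis by (auto simp: A_def)
  qed
  have "SHAP N f x i P = (\<Sum>S\<in>(\<Union>k<N. A k). shapley_weight N (card S) * (v S - v (S - {i})))"
    unfolding SHAP_def shapley_weight_def proper v_def ..
  also have "\<dots> = (\<Sum>k<N. \<Sum>S\<in>A k. shapley_weight N (card S) * (v S - v (S - {i})))"
    by (rule sum.UNION_disjoint) (use finA in \<open>auto simp: A_def\<close>)
  also have "\<dots> = (\<Sum>k<N. shapley_weight N k * (\<Sum>S\<in>A k. v S - v (S - {i})))"
    by (simp add: A_def sum_distrib_left)
  also have "\<dots> = (\<Sum>k<N. shapley_weight N k * (layer v N {} k - layer v N {i} k
      - (case k of 0 \<Rightarrow> 0 | Suc l \<Rightarrow> layer v N {i} l)))"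
  proof (intro sum.cong refl arg_cong[where f = "(*) (shapley_weight N _)"])
    fix k
    let ?B = "{S \<in> A k. i \<in> S}" and ?D = "{S. S \<subseteq> {1..N} - {i} \<and> card S = k}"
    have split: "A k = ?B \<union> ?D" "?B \<inter> ?D = {}" by (auto simp: A_def)
    have fin: "finite ?B" "finite ?D"
      by (rule finite_subset[OF _ finA[of k]], auto simp: A_def)+
    have "(\<Sum>S\<in>A k. v S - v (S - {i})) = (\<Sum>S\<in>?B. v S - v (S - {i}))"
      by (rule sum.mono_neutral_right) (auto simp: finA)
    also have "\<dots> = (\<Sum>S\<in>?B. v S) - (\<Sum>S\<in>?B. v (S - {i}))" by (rule sum_subtractf)
    also have "(\<Sum>S\<in>?B. v S) = (\<Sum>S\<in>A k. v S) - (\<Sum>S\<in>?D. v S)"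
      using sum.union_disjoint[OF fin split(2), of v] unfolding split(1)[symmetric] by simp
    also have "(\<Sum>S\<in>?B. v (S - {i})) = (case k of 0 \<Rightarrow> 0 | Suc l \<Rightarrow> layer v N {i} l)"
    proof (cases k)
      case 0
      then have empty: "?B = {}" by (auto simp: A_def dest: finite_subset)
      show ?thesis unfolding empty by (simp add: 0)
    next
      case (Suc l)
      have card: "card (insert i S) = Suc (card S)" if "S \<subseteq> {1..N} - {i}" for S
        by (rule card_insert_disjoint) (use that finite_subset[OF that] in auto)
      have "(\<Sum>S\<in>?B. v (S - {i})) = layer v N {i} l"
        unfolding layer_def ivl
        by (rule sum.reindex_bij_witness[of _ "insert i" "\<lambda>S. S - {i}"])
          (use assms Suc card in \<open>auto simp: A_def insert_absorb dest: finite_subset\<close>)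
      then show ?thesis using Suc by simp
    qed
    finally show "(\<Sum>S\<in>A k. v S - v (S - {i})) = layer v N {} k - layer v N {i} k
      - (case k of 0 \<Rightarrow> 0 | Suc l \<Rightarrow> layer v N {i} l)"
      unfolding layer_def ivl A_def Diff_empty .
  qed
  finally show ?thesis unfolding v_def .
qed

text \<open>All clauses share the normalising mass, so their conditional probabilities add up. The
  instance \<open>y\<close> is replaced by \<open>x\<close>, which agrees with it on
  \<open>{1..N}\<close> and has the prescribed value at the virtual start.\<close>

lemma SHAP_eq_path_scores:
  assumes \<Phi>: "disjoint_dnf \<Phi>" "nvars \<Phi> = N" and i: "i \<in> {1..N}" and M: "wf_markov N M"
    and x: "x 0" "\<And>j. j \<in> {1..N} \<Longrightarrow> x j = y j"
    and t0: "\<And>b. t 0 True b = init M b"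
    and t: "\<And>j a b. 1 \<le> j \<Longrightarrow> j < N \<Longrightarrow> t j a b = transition M j a b"
    and tN: "\<And>a b. t N a b = 1"
  shows "SHAP N (dnf_fun \<Phi>) y i (markov_pmf N M) = (\<Sum>C\<leftarrow>clauses \<Phi>.
    \<Sum>k<N. path_score (ratio x t (clause_guard (map enc_lit C))) N i k)"
proof -
  let ?v = "cond_value (dnf_fun \<Phi>) y (markov_pmf N M)"
  let ?m = "length (clauses \<Phi>)"
  define g where "g = (\<lambda>c. clause_guard (map enc_lit (clauses \<Phi> ! c)))"
  have N: "N \<ge> 1" using i by simp
  have lits: "\<forall>l\<in>set (clauses \<Phi> ! c). lit_var l \<in> {1..N}" if "c < ?m" for c
    using \<Phi> nth_mem[OF that] unfolding disjoint_dnf_def wf_dnf_def by auto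
  \<comment> \<open>No literal mentions the virtual position \<open>N + 1\<close>.\<close>
  have gN: "g c (Suc N) b = 1" if "c < ?m" for c b
  proof -
    have "enc_lit l \<noteq> int (Suc N) \<and> enc_lit l \<noteq> - int (Suc N)" if "l \<in> set (clauses \<Phi> ! c)" for l
      using bspec[OF lits[OF \<open>c < ?m\<close>] that] by (cases l) auto
    then have "int (Suc N) \<notin> enc_lit ` set (clauses \<Phi> ! c)" "- int (Suc N) \<notin> enc_lit ` set (clauses \<Phi> ! c)"
      by (metis imageE)+
    then show ?thesis by (simp add: g_def clause_guard_def del: of_nat_Suc)
  qed
  have v: "?v S = (\<Sum>c<?m. path_value x t (g c) S (Suc N))" if S: "S \<subseteq> {1..N}" for S
  proof -
    have agree: "agree y S X \<longleftrightarrow> agree x S X" for X using S x(2) by (auto simp: agree_def)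
    have "(\<Sum>X\<in>cube N. of_bool (agree x S X) * (markov_weight N M X * dnf_fun \<Phi> X)) =
      (\<Sum>X\<in>cube N. \<Sum>c<?m. of_bool (agree x S X) * (markov_weight N M X * (\<Prod>j=1..N. g c j (X j))))"
      unfolding dnf_fun_eq_sum[OF \<Phi>(1)] sum_distrib_left g_def
      by (intro sum.cong refl) (simp only: clause_true_eq_prod[OF lits] lessThan_iff)
    also have "\<dots> = (\<Sum>c<?m. guarded_mass N M x (g c) S)"
      unfolding guarded_mass_def by (rule sum.swap)
    finally have "?v S = (\<Sum>c<?m. guarded_mass N M x (g c) S) / guarded_mass N M x (\<lambda>_ _. 1) S"
      unfolding cond_value_markov[OF M N S] agree by (simp add: guarded_mass_def)
    moreover have "guarded_mass N M x h S = forward x t S h 0 (Suc N) (x (Suc N))" if "\<And>b. h (Suc N) b = 1" for h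
      by (rule forward_Suc_eq_guarded_mass[symmetric]) (use N S x t0 t tN that in auto)
    ultimately show ?thesis using gN
      by (simp add: path_value_def sum_divide_distrib del: forward.simps)
  qed
  have layer: "layer ?v N E k = (\<Sum>c<?m. dp (ratio x t (g c)) E (Suc k) (Suc N))" if "Suc N \<notin> E" for E k
  proof -
    have "layer ?v N E k = (\<Sum>S | S \<subseteq> {1..<Suc N} - E \<and> card S = k. \<Sum>c<?m. path_value x t (g c) S (Suc N))"
      unfolding layer_def by (intro sum.cong refl v) auto
    then show ?thesis using that by (subst (asm) sum.swap) (simp add: dp_eq_sum del: dp.simps)
  qed
  have "SHAP N (dnf_fun \<Phi>) y i (markov_pmf N M) =
    (\<Sum>k<N. \<Sum>c<?m. path_score (ratio x t (g c)) N i k)"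
    unfolding SHAP_eq_layers[OF i]
  proof (intro sum.cong refl)
    fix k
    \<comment> \<open>For \<open>k = 0\<close> the right-hand side is the indicator of node 0 taken
      at \<open>N + 1\<close>, hence 0.\<close>
    have "(case k of 0 \<Rightarrow> 0 | Suc l \<Rightarrow> layer ?v N {i} l) = (\<Sum>c<?m. dp (ratio x t (g c)) {i} k (Suc N))"
      using layer[of "{i}"] i by (cases k) auto
    then show "shapley_weight N k * (layer ?v N {} k - layer ?v N {i} k
        - (case k of 0 \<Rightarrow> 0 | Suc l \<Rightarrow> layer ?v N {i} l)) = (\<Sum>c<?m. path_score (ratio x t (g c)) N i k)"
      using layer[of "{}" k] layer[of "{i}" k] i
      by (simp add: path_score_def sum_subtractf sum_distrib_left[symmetric] del: dp.simps)
  qed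
  also have "\<dots> = (\<Sum>c<?m. \<Sum>k<N. path_score (ratio x t (g c)) N i k)" by (rule sum.swap)
  also have "\<dots> = (\<Sum>C\<leftarrow>clauses \<Phi>. \<Sum>k<N. path_score (ratio x t (clause_guard (map enc_lit C))) N i k)"
    by (simp add: sum_list_sum_nth g_def atLeast0LessThan)
  finally show ?thesis .
qed

section \<open>The program\<close>

text \<open>The values at the two virtual positions need no storage of their own.  At position 0 the
  instance cell read is that of the index \<open>i \<ge> 1\<close>, which counts as true.  At position \<open>N + 1\<close> it is
  the first cell after the instance; its value is irrelevant as all transitions into \<open>N + 1\<close> are 1.\<close>

definition point_in :: "(int \<Rightarrow> int) \<Rightarrow> nat \<Rightarrow> bool" where
  "point_in v j \<longleftrightarrow> v (2 + int j) \<noteq> 0"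

text \<open>For \<open>j = 0\<close> the addresses are -2 to 1, so the initial distribution is the row of the
  transition out of the virtual value \<open>True\<close>.\<close>

definition transition_in :: "(int \<Rightarrow> real) \<Rightarrow> nat \<Rightarrow> bool \<Rightarrow> bool \<Rightarrow> real" where
  "transition_in v j a b = v (4 * int j + (2 * of_bool a + of_bool b - 2))"

text \<open>With this layout a literal \<open>z\<close> in DIMACS form forbids exactly the value at cell \<open>- z\<close>.\<close>

definition guard_in :: "(int \<Rightarrow> real) \<Rightarrow> nat \<Rightarrow> bool \<Rightarrow> real" where
  "guard_in v j b = v (if b then int j else - int j)"

section \<open>The quotient for one gap\<close>

definition ratio_of :: "state \<Rightarrow> nat \<Rightarrow> nat \<Rightarrow> real" where
  "ratio_of s = ratio (point_in (ints s ''in'')) (transition_in (reals s ''in'')) (guard_in (reals s ''g''))"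

text \<open>Integer expressions have no multiplication, so \<open>4 * j\<close> is a sum of four
  copies of \<open>j\<close>.\<close>

definition trans_cell :: "bool \<Rightarrow> bool \<Rightarrow> rexp" where
  "trans_cell a b = RCell ''in''
     (IAdd (IAdd (IAdd (ivar ''j'') (ivar ''j'')) (IAdd (ivar ''j'') (ivar ''j'')))
           (INum (2 * of_bool a + of_bool b - 2)))"

definition column :: "string \<Rightarrow> bool \<Rightarrow> rexp" where
  "column v b = RAdd (RMul (RCell v (INum 0)) (trans_cell False b))
                     (RMul (RCell v (INum 1)) (trans_cell True b))"

text \<open>\<open>v\<close> buffers the new \<open>False\<close> entry, since the
  \<open>True\<close> entry is still computed from the old pair. The address \<open>- 1 - j\<close>
  is the guard cell for \<open>False\<close> at position \<open>j + 1\<close>.\<close>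

definition advance :: com where
  "advance = block
     [rset ''v'' (RMul (column ''u'' False) (RCell ''g'' (ISub (INum (- 1)) (ivar ''j'')))),
      RAssign ''u'' (INum 1) (RMul (column ''u'' True) (RCell ''g'' (IAdd (ivar ''j'') (INum 1)))),
      RAssign ''u'' (INum 0) (rvar ''v''),
      rset ''v'' (column ''d'' False),
      RAssign ''d'' (INum 1) (column ''d'' True),
      RAssign ''d'' (INum 0) (rvar ''v''),
      iset ''j'' (IAdd (ivar ''j'') (INum 1))]"

definition start :: com where
  "start = Seq (Cond (IEq (ICell ''in'' (IAdd (INum 2) (ivar ''s''))) (INum 0))
       (block [RAssign ''u'' (INum 0) (RNum 1), RAssign ''u'' (INum 1) (RNum 0),
               RAssign ''d'' (INum 0) (RNum 1), RAssign ''d'' (INum 1) (RNum 0)])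
       (block [RAssign ''u'' (INum 0) (RNum 0), RAssign ''u'' (INum 1) (RNum 1),
               RAssign ''d'' (INum 0) (RNum 0), RAssign ''d'' (INum 1) (RNum 1)]))
     (iset ''j'' (ivar ''s''))"

definition compute_ratio :: com where
  "compute_ratio = block
     [start,
      While (ILess (ivar ''j'') (ivar ''e'')) advance,
      Cond (IEq (ICell ''in'' (IAdd (INum 2) (ivar ''e''))) (INum 0))
       (rset ''r'' (RDiv (RCell ''u'' (INum 0)) (RCell ''d'' (INum 0))))
       (rset ''r'' (RDiv (RCell ''u'' (INum 1)) (RCell ''d'' (INum 1))))]"

lemma runs_advance:
  assumes "ints s ''j'' 0 = int (k + m)"
    and "\<And>b. reals s ''u'' (of_bool b) = forward x t {} g k m b"
    and "\<And>b. reals s ''d'' (of_bool b) = forward x t {} (\<lambda>_ _. 1) k m b"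
    and t: "t = transition_in (reals s ''in'')" and g: "g = guard_in (reals s ''g'')"
  shows "runs n advance s (\<lambda>s'. ints s' ''j'' 0 = int (k + Suc m) \<and>
    (\<forall>b. reals s' ''u'' (of_bool b) = forward x t {} g k (Suc m) b) \<and>
    (\<forall>b. reals s' ''d'' (of_bool b) = forward x t {} (\<lambda>_ _. 1) k (Suc m) b))"
proof -
  have T: "reals s ''in'' (4 * (int k + int m) + (2 * of_bool a + of_bool b - 2)) = t (k + m) a b" for a b
    by (simp add: t transition_in_def)
  note T' = T[of False False, simplified] T[of False True, simplified]
    T[of True False, simplified] T[of True True, simplified]
  have G: "reals s ''g'' (int k + int m + 1) = g (Suc (k + m)) True"
     "reals s ''g'' (- 1 - (int k + int m)) = g (Suc (k + m)) False"
    by (simp_all add: g guard_in_def algebra_simps)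
  have u: "reals s ''u'' 0 = forward x t {} g k m False" "reals s ''u'' 1 = forward x t {} g k m True"
    and d: "reals s ''d'' 0 = forward x t {} (\<lambda>_ _. 1) k m False" "reals s ''d'' 1 = forward x t {} (\<lambda>_ _. 1) k m True"
    using assms(2)[of False] assms(2)[of True] assms(3)[of False] assms(3)[of True] by auto
  have j: "i + i + (i + i) = 4 * i" for i :: int by simp
  show ?thesis
    unfolding advance_def block.simps
    \<comment> \<open>Symbolic execution of straight-line code: \<open>runs_Seq\<close> exposes the
      next assignment, and simplification carries it out in the postcondition.\<close>
    by ((rule runs_Seq)?, simp add: assms(1) column_def trans_cell_def j T' G u d UNIV_bool all_bool_eq)+
qed

lemma writes_advance [simp]:
  "int_writes advance = {''j''}" "real_writes advance = {''u'', ''v'', ''d''}"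
  by (auto simp: advance_def)

lemma writes_compute_ratio [simp]:
  "int_writes compute_ratio = {''j''}" "real_writes compute_ratio = {''u'', ''v'', ''d'', ''r''}"
  by (auto simp: compute_ratio_def start_def)

lemma runs_start:
  assumes "ints s ''s'' 0 = int k"
  shows "runs n start s (\<lambda>s'. ints s' ''j'' 0 = int k \<and>
    (\<forall>b. reals s' ''u'' (of_bool b) = of_bool (b = point_in (ints s ''in'') k)) \<and>
    (\<forall>b. reals s' ''d'' (of_bool b) = of_bool (b = point_in (ints s ''in'') k)))"
  unfolding start_def block.simps
  apply (rule runs_Seq runs_Cond)+
  by ((rule runs_Seq)?, simp add: assms point_in_def all_bool_eq)+

lemma runs_compute_ratio:
  assumes s: "ints s ''s'' 0 = int k" and e: "ints s ''e'' 0 = int e" and "k \<le> e" "e - k \<le> n"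
  shows "runs n compute_ratio s (\<lambda>s'. reals s' ''r'' 0 = ratio_of s k e)"
proof -
  let ?x = "point_in (ints s ''in'')" and ?t = "transition_in (reals s ''in'')"
    and ?g = "guard_in (reals s ''g'')"
  define I where "I = (\<lambda>m (s'::state). ints s' ''j'' 0 = int (k + m) \<and>
    (\<forall>b. reals s' ''u'' (of_bool b) = forward ?x ?t {} ?g k m b) \<and>
    (\<forall>b. reals s' ''d'' (of_bool b) = forward ?x ?t {} (\<lambda>_ _. 1) k m b))"
  show ?thesis
    unfolding compute_ratio_def block.simps
  proof (rule runs_Seq, rule runs_mono, rule runs_start[OF s], rule runs_Seq)
    fix s1
    assume keeps1: "keeps start s s1" and start:
     "ints s1 ''j'' 0 = int k \<and>
      (\<forall>b. reals s1 ''u'' (of_bool b) = of_bool (b = ?x k)) \<and>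
      (\<forall>b. reals s1 ''d'' (of_bool b) = of_bool (b = ?x k))"
    have [simp]: "ints s1 ''e'' = ints s ''e''" "ints s1 ''in'' = ints s ''in''"
      "reals s1 ''in'' = reals s ''in''" "reals s1 ''g'' = reals s ''g''"
      using keeps1 by (simp_all add: keeps_def start_def)
    show "runs n (While (ILess (ivar ''j'') (ivar ''e'')) advance) s1
      (\<lambda>s'. runs n (Cond (IEq (ICell ''in'' (IAdd (INum 2) (ivar ''e''))) (INum 0))
       (rset ''r'' (RDiv (RCell ''u'' (INum 0)) (RCell ''d'' (INum 0))))
       (rset ''r'' (RDiv (RCell ''u'' (INum 1)) (RCell ''d'' (INum 1))))) s'
       (\<lambda>s'. reals s' ''r'' 0 = ratio_of s k e))"
    proof (rule runs_While[of I _ "e - k"])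
      show "I 0 s1" using start by (simp add: I_def)
    next
      fix m s' assume m: "m < e - k" and keeps: "keeps advance s1 s'" and I: "I m s'"
      have [simp]: "ints s' ''e'' = ints s ''e''" using keeps by (simp add: keeps_def)
      have "?t = transition_in (reals s' ''in'')" "?g = guard_in (reals s' ''g'')"
        using keeps by (simp_all add: keeps_def)
      then have "runs n advance s' (I (Suc m))"
        unfolding I_def by (intro runs_advance) (use I in \<open>auto simp: I_def\<close>)
      then show "bval (ILess (ivar ''j'') (ivar ''e'')) s' \<and> runs n advance s' (I (Suc m))"
        using e m I by (simp add: I_def)
    next
      fix s' assume keeps: "keeps advance s1 s'" and I: "I (e - k) s'"
      have [simp]: "ints s' ''e'' = ints s ''e''" "ints s' ''in'' = ints s ''in''"
        using keeps by (simp_all add: keeps_def)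
      have "reals s' ''u'' 0 = forward ?x ?t {} ?g k (e - k) False"
        "reals s' ''u'' 1 = forward ?x ?t {} ?g k (e - k) True"
        "reals s' ''d'' 0 = forward ?x ?t {} (\<lambda>_ _. 1) k (e - k) False"
        "reals s' ''d'' 1 = forward ?x ?t {} (\<lambda>_ _. 1) k (e - k) True"
        using I by (auto simp: I_def all_bool_eq)
      then show "\<not> bval (ILess (ivar ''j'') (ivar ''e'')) s' \<and>
        runs n (Cond (IEq (ICell ''in'' (IAdd (INum 2) (ivar ''e''))) (INum 0))
         (rset ''r'' (RDiv (RCell ''u'' (INum 0)) (RCell ''d'' (INum 0))))
         (rset ''r'' (RDiv (RCell ''u'' (INum 1)) (RCell ''d'' (INum 1))))) s'
         (\<lambda>s'. reals s' ''r'' 0 = ratio_of s k e)"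
        using I \<open>k \<le> e\<close> e
        by (auto intro!: runs_Cond simp: I_def ratio_of_def ratio_def point_in_def)
    qed fact
  qed
qed

section \<open>Adding one edge to all paths\<close>

definition row_step :: com where
  "row_step = block
     [compute_ratio,
      rset ''a'' (RAdd (rvar ''a'') (RMul (RCell ''A'' (ivar ''s'')) (rvar ''r''))),
      rset ''b'' (RAdd (rvar ''b'') (RMul (RCell ''D'' (ivar ''s'')) (rvar ''r''))),
      iset ''s'' (IAdd (ivar ''s'') (INum 1))]"

text \<open>The tables are updated in place, which is sound because \<open>e\<close> runs downwards.\<close>

definition row :: com where
  "row = block
     [iset ''s'' (INum 0), rset ''a'' (RNum 0), rset ''b'' (RNum 0),
      While (ILess (ivar ''s'') (ivar ''e'')) row_step,
      RAssign ''A'' (ivar ''e'') (rvar ''a''),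
      RAssign ''D'' (ivar ''e'') (rvar ''b''),
      iset ''e'' (ISub (ivar ''e'') (INum 1))]"

lemma writes_row_step [simp]:
  "int_writes row_step = {''j'', ''s''}"
  "real_writes row_step = {''u'', ''v'', ''d'', ''r'', ''a'', ''b''}"
  by (auto simp: row_step_def)

lemma writes_row [simp]:
  "int_writes row = {''j'', ''s'', ''e''}"
  "real_writes row = {''u'', ''v'', ''d'', ''r'', ''a'', ''b'', ''A'', ''D''}"
  by (auto simp: row_def)

text \<open>The quotients depend only on the input and the guards, so during the work on one clause
  they can be named by a fixed table \<open>R\<close> although the state changes.\<close>

lemma ratio_of_cong:
  "ints s' ''in'' = ints s ''in'' \<Longrightarrow> reals s' ''in'' = reals s ''in'' \<Longrightarrow> reals s' ''g'' = reals s ''g''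
   \<Longrightarrow> ratio_of s' = ratio_of s"
  by (simp add: ratio_of_def)

lemma runs_row_step:
  assumes s: "ints s ''s'' 0 = int k" and e: "ints s ''e'' 0 = int e" and "k < e" "e \<le> n"
    and R: "R k e = ratio_of s k e"
    and "reals s ''a'' 0 = (\<Sum>j<k. f j * R j e)" "reals s ''b'' 0 = (\<Sum>j<k. h j * R j e)"
    and "reals s ''A'' (int k) = f k" "reals s ''D'' (int k) = h k"
  shows "runs n row_step s (\<lambda>s'. ints s' ''s'' 0 = int (Suc k) \<and>
    reals s' ''a'' 0 = (\<Sum>j<Suc k. f j * R j e) \<and> reals s' ''b'' 0 = (\<Sum>j<Suc k. h j * R j e))"
  unfolding row_step_def block.simps
proof (rule runs_Seq, rule runs_mono, rule runs_compute_ratio[OF s e])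
  fix s1 assume "keeps compute_ratio s s1" "reals s1 ''r'' 0 = ratio_of s k e"
  moreover from this(1) have "ints s1 ''s'' = ints s ''s''"
    "reals s1 ''a'' = reals s ''a''" "reals s1 ''b'' = reals s ''b''"
    "reals s1 ''A'' = reals s ''A''" "reals s1 ''D'' = reals s ''D''"
    by (simp_all add: keeps_def)
  ultimately show "runs n (Seq (rset ''a'' (RAdd (rvar ''a'') (RMul (RCell ''A'' (ivar ''s'')) (rvar ''r''))))
      (Seq (rset ''b'' (RAdd (rvar ''b'') (RMul (RCell ''D'' (ivar ''s'')) (rvar ''r''))))
      (iset ''s'' (IAdd (ivar ''s'') (INum 1))))) s1 (\<lambda>s'. ints s' ''s'' 0 = int (Suc k) \<and>
      reals s' ''a'' 0 = (\<Sum>j<Suc k. f j * R j e) \<and> reals s' ''b'' 0 = (\<Sum>j<Suc k. h j * R j e))"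
    using assms by - ((rule runs_Seq)?, simp)+
qed (use assms in auto)

lemma runs_row:
  assumes e: "ints s ''e'' 0 = int e" and "e \<le> n" and R: "\<And>j. j < e \<Longrightarrow> R j e = ratio_of s j e"
    and A: "\<And>j. j < e \<Longrightarrow> reals s ''A'' (int j) = f j" and D: "\<And>j. j < e \<Longrightarrow> reals s ''D'' (int j) = h j"
  shows "runs n row s (\<lambda>s'. ints s' ''e'' 0 = int e - 1 \<and>
    reals s' ''A'' = (reals s ''A'')(int e := \<Sum>j<e. f j * R j e) \<and>
    reals s' ''D'' = (reals s ''D'')(int e := \<Sum>j<e. h j * R j e))"
proof -
  define I where "I = (\<lambda>k (s'::state). ints s' ''s'' 0 = int k \<and>
    reals s' ''a'' 0 = (\<Sum>j<k. f j * R j e) \<and> reals s' ''b'' 0 = (\<Sum>j<k. h j * R j e))"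
  define s1 where "s1 = set_real ''b'' 0 0 (set_real ''a'' 0 0 (set_int ''s'' 0 0 s))"
  have [simp]: "ratio_of s1 = ratio_of s" "ints s1 ''e'' = ints s ''e''"
    "reals s1 ''A'' = reals s ''A''" "reals s1 ''D'' = reals s ''D''"
    by (simp_all add: ratio_of_def s1_def)
  have "runs n (While (ILess (ivar ''s'') (ivar ''e'')) row_step) s1 (\<lambda>s'. keeps row_step s1 s' \<and> I e s')"
  proof (rule runs_While[of I _ e])
    show "I 0 s1" by (simp add: I_def s1_def)
  next
    fix k s' assume k: "k < e" and keeps: "keeps row_step s1 s'" and I: "I k s'"
    have [simp]: "ints s' ''e'' = ints s ''e''" "reals s' ''A'' = reals s ''A''"
      "reals s' ''D'' = reals s ''D''" "ratio_of s' = ratio_of s"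
      using keeps ratio_of_cong[of s' s1] by (simp_all add: keeps_def)
    have "runs n row_step s' (I (Suc k))"
      unfolding I_def
      by (rule runs_row_step) (use I k e A D R \<open>e \<le> n\<close> in \<open>auto simp: I_def\<close>)
    then show "bval (ILess (ivar ''s'') (ivar ''e'')) s' \<and> runs n row_step s' (I (Suc k))"
      using I e k by (simp add: I_def)
  next
    fix s' assume "keeps row_step s1 s'" "I e s'"
    then show "\<not> bval (ILess (ivar ''s'') (ivar ''e'')) s' \<and> keeps row_step s1 s' \<and> I e s'"
      using e by (simp add: keeps_def I_def)
  qed fact
  then show ?thesis
    unfolding row_def block.simps
    apply -
    apply (rule runs_Seq, simp)+
    apply (fold s1_def)
    apply (rule runs_Seq, erule runs_mono)
    by ((rule runs_Seq)?, simp add: keeps_def e I_def)+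
qed

text \<open>Both tables undergo the same update; avoidance of \<open>i\<close> is then enforced by
  clearing one cell. Row 0 is included because no path with an edge ends in 0, so its entry has to
  become 0.\<close>

definition round :: com where
  "round = block
     [iset ''e'' (IAdd (ICell ''in'' (INum 0)) (INum 1)),
      While (ILess (INum (- 1)) (ivar ''e'')) row,
      RAssign ''D'' (ICell ''in'' (INum 2)) (RNum 0)]"

lemma writes_round [simp]:
  "int_writes round = {''j'', ''s'', ''e''}"
  "real_writes round = {''u'', ''v'', ''d'', ''r'', ''a'', ''b'', ''A'', ''D''}"
  by (auto simp: round_def)

definition tables :: "(nat \<Rightarrow> nat \<Rightarrow> real) \<Rightarrow> nat \<Rightarrow> nat \<Rightarrow> nat \<Rightarrow> state \<Rightarrow> bool" where
  "tables R N i k s \<longleftrightarrow> (\<forall>j\<le>Suc N. reals s ''A'' (int j) = dp R {} k j \<and> reals s ''D'' (int j) = dp R {i} k j)"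

lemma runs_round:
  assumes N: "ints s ''in'' 0 = int N" and i: "ints s ''in'' 2 = int i" and n: "N + 2 \<le> n"
    and R: "\<And>j e. j < e \<Longrightarrow> e \<le> Suc N \<Longrightarrow> R j e = ratio_of s j e"
    and tables: "tables R N i k s"
  shows "runs n round s (tables R N i (Suc k))"
proof -
  define f where "f = dp R {} k"
  define h where "h = dp R {i} k"
  \<comment> \<open>After \<open>m\<close> rows exactly the cells above \<open>N + 1 - m\<close> are
    new, and the remaining rows read only cells below that bound.\<close>
  define I where "I = (\<lambda>m (s'::state). ints s' ''e'' 0 = int (Suc N) - int m \<and>
    (\<forall>j\<le>Suc N.
      reals s' ''A'' (int j) = (if Suc N < j + m then \<Sum>l<j. f l * R l j else f j) \<and>
      reals s' ''D'' (int j) = (if Suc N < j + m then \<Sum>l<j. h l * R l j else h j)))"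
  define s1 where "s1 = set_int ''e'' 0 (int N + 1) s"
  have s1: "ratio_of s1 = ratio_of s" "ints s1 ''in'' = ints s ''in''"
    by (simp_all add: ratio_of_def s1_def)
  have "runs n (While (ILess (INum (- 1)) (ivar ''e'')) row) s1 (\<lambda>s'. keeps row s1 s' \<and> I (N + 2) s')"
  proof (rule runs_While[of I _ "N + 2"])
    show "I 0 s1" using tables by (auto simp: I_def s1_def tables_def f_def h_def)
  next
    fix m s' assume m: "m < N + 2" and keeps: "keeps row s1 s'" and I: "I m s'"
    have ratio: "ratio_of s' = ratio_of s"
      using keeps ratio_of_cong[of s' s1] s1 by (simp add: keeps_def)
    obtain e where e: "e + m = Suc N" using m by (metis add_2_eq_Suc' add.commute less_Suc_eq_le le_Suc_ex)
    have es': "ints s' ''e'' 0 = int e" using I e by (simp add: I_def)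
    have "runs n row s' (\<lambda>s'a. ints s'a ''e'' 0 = int e - 1 \<and>
      reals s'a ''A'' = (reals s' ''A'')(int e := \<Sum>j<e. f j * R j e) \<and>
      reals s'a ''D'' = (reals s' ''D'')(int e := \<Sum>j<e. h j * R j e))"
      by (rule runs_row[OF es']) (use I e n R ratio in \<open>auto simp: I_def\<close>)
    then have "runs n row s' (I (Suc m))"
    proof (rule runs_mono)
      fix s'' :: state
      assume *: "ints s'' ''e'' 0 = int e - 1 \<and>
        reals s'' ''A'' = (reals s' ''A'')(int e := \<Sum>j<e. f j * R j e) \<and>
        reals s'' ''D'' = (reals s' ''D'')(int e := \<Sum>j<e. h j * R j e)"
      have "Suc N < j + Suc m \<longleftrightarrow> Suc N < j + m \<or> j = e" for j using e by auto
      moreover have "\<not> Suc N < e + m" using e by simp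
      ultimately show "I (Suc m) s''" using * I e by (auto simp: I_def)
    qed
    then show "bval (ILess (INum (- 1)) (ivar ''e'')) s' \<and> runs n row s' (I (Suc m))"
      using es' by simp
  next
    fix s' assume "keeps row s1 s'" "I (N + 2) s'"
    then show "\<not> bval (ILess (INum (- 1)) (ivar ''e'')) s' \<and> keeps row s1 s' \<and> I (N + 2) s'"
      by (simp add: I_def)
  qed (use n in simp)
  then show ?thesis
    unfolding round_def block.simps
    apply -
    apply (rule runs_Seq, simp add: N)
    apply (fold s1_def)
    apply (rule runs_Seq, erule runs_mono)
    by (simp add: keeps_def s1 i I_def tables_def f_def h_def)
qed

text \<open>In the last iteration the update of \<open>w\<close> divides by 0, but \<open>w\<close> is then no longer used.\<close>

definition score_step :: com where
  "score_step = block
     [rset ''out'' (RSub (rvar ''out'') (RMul (rvar ''w'') (RCell ''D'' (IAdd (ICell ''in'' (INum 0)) (INum 1))))),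
      round,
      rset ''out'' (RAdd (rvar ''out'') (RMul (rvar ''w'')
        (RSub (RCell ''A'' (IAdd (ICell ''in'' (INum 0)) (INum 1)))
              (RCell ''D'' (IAdd (ICell ''in'' (INum 0)) (INum 1)))))),
      rset ''q'' (RAdd (rvar ''q'') (RNum 1)),
      rset ''w'' (RDiv (RMul (rvar ''w'') (rvar ''q'')) (RSub (rvar ''n'') (rvar ''q''))),
      iset ''k'' (IAdd (ivar ''k'') (INum 1))]"

lemma writes_score_step [simp]:
  "int_writes score_step = {''j'', ''s'', ''e'', ''k''}"
  "real_writes score_step = {''u'', ''v'', ''d'', ''r'', ''a'', ''b'', ''A'', ''D'', ''out'', ''q'', ''w''}"
  by (auto simp: score_step_def)

text \<open>Consecutive weights have a simple quotient, so the program never computes a factorial.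
  The quotient is formed from real copies of \<open>k\<close> and \<open>N\<close>, as real
  expressions cannot read integer cells.\<close>

lemma shapley_weight_Suc:
  assumes "Suc k < N"
  shows "shapley_weight N (Suc k) = shapley_weight N k * (1 + real k) / (real N - (1 + real k))"
proof -
  have "N - k - 1 = Suc (N - Suc k - 1)" using assms by simp
  then have *: "fact (N - k - 1) = (real N - (1 + real k)) * fact (N - Suc k - 1)"
    using assms by (simp add: of_nat_diff)
  have "real N - (1 + real k) \<noteq> 0" using assms by linarith
  then show ?thesis unfolding shapley_weight_def * by simp
qed

text \<open>The last term of \<open>path_score\<close> refers to the table before the new edge is
  added, hence the subtraction ahead of \<open>round\<close>.\<close>

lemma runs_score_step:
  assumes N: "ints s ''in'' 0 = int N" and i: "ints s ''in'' 2 = int i" and n: "N + 2 \<le> n"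
    and R: "\<And>j e. j < e \<Longrightarrow> e \<le> Suc N \<Longrightarrow> R j e = ratio_of s j e"
    and tables: "tables R N i k s" and rn: "reals s ''n'' 0 = real N"
    and k: "ints s ''k'' 0 = int k" "reals s ''q'' 0 = real k" and w: "reals s ''w'' 0 = shapley_weight N k"
  shows "runs n score_step s (\<lambda>s'. tables R N i (Suc k) s' \<and>
    ints s' ''k'' 0 = int (Suc k) \<and> reals s' ''q'' 0 = real (Suc k) \<and>
    (Suc k < N \<longrightarrow> reals s' ''w'' 0 = shapley_weight N (Suc k)) \<and>
    reals s' ''out'' 0 = reals s ''out'' 0 + path_score R N i k)"
proof -
  have D: "reals s ''D'' (int N + 1) = dp R {i} k (Suc N)"
    using tables unfolding tables_def by (metis le_refl of_nat_Suc add.commute)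
  define s1 where "s1 = set_real ''out'' 0 (reals s ''out'' 0 - shapley_weight N k * dp R {i} k (Suc N)) s"
  have "runs n round s1 (tables R N i (Suc k))"
    by (rule runs_round) (use assms in \<open>auto simp: s1_def tables_def ratio_of_def\<close>)
  then show ?thesis
    unfolding score_step_def block.simps
    apply -
    apply (rule runs_Seq, simp add: N D w)
    apply (fold s1_def)
    apply (rule runs_Seq, erule runs_mono)
    subgoal for s2
    proof -
      assume keeps: "keeps round s1 s2" and tables2: "tables R N i (Suc k) s2"
      have [simp]: "ints s2 ''k'' 0 = int k" "reals s2 ''q'' 0 = real k"
        "reals s2 ''w'' 0 = shapley_weight N k" "reals s2 ''n'' 0 = real N"
        "ints s2 ''in'' 0 = int N"
        "reals s2 ''out'' 0 = reals s ''out'' 0 - shapley_weight N k * dp R {i} k (Suc N)"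
        using keeps k w rn N by (simp_all add: keeps_def s1_def)
      have AD: "reals s2 ''A'' (int N + 1) = dp R {} (Suc k) (Suc N)"
        "reals s2 ''D'' (int N + 1) = dp R {i} (Suc k) (Suc N)"
        using tables2 unfolding tables_def by (metis le_refl of_nat_Suc add.commute)+
      note AD' = AD[unfolded add.commute[of "int N" 1]]
      show ?thesis
        using tables2
        by - ((rule runs_Seq)?, simp add: AD AD' tables_def shapley_weight_Suc path_score_def algebra_simps del: dp.simps)+
    qed
    done
qed

section \<open>Processing one clause\<close>

definition reset :: com where
  "reset = block
     [iset ''j'' (INum 0),
      While (ILess (ivar ''j'') (IAdd (ICell ''in'' (INum 0)) (INum 2)))
        (block [RAssign ''A'' (ivar ''j'') (RNum 0), RAssign ''D'' (ivar ''j'') (RNum 0),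
          RAssign ''g'' (ivar ''j'') (RNum 1), RAssign ''g'' (ISub (INum 0) (ivar ''j'')) (RNum 1),
          iset ''j'' (IAdd (ivar ''j'') (INum 1))]),
      RAssign ''A'' (INum 0) (RNum 1), RAssign ''D'' (INum 0) (RNum 1),
      iset ''k'' (INum 0), rset ''q'' (RNum 0), rset ''w'' (RDiv (RNum 1) (rvar ''n''))]"

definition scan :: com where
  "scan = While (BNot (IEq (ICell ''in'' (ivar ''p'')) (INum 0)))
     (block [RAssign ''g'' (ISub (INum 0) (ICell ''in'' (ivar ''p''))) (RNum 0),
             iset ''p'' (IAdd (ivar ''p'') (INum 1))])"

definition process_clause :: com where
  "process_clause = block
     [reset, scan, iset ''p'' (IAdd (ivar ''p'') (INum 1)),
      While (ILess (ivar ''k'') (ICell ''in'' (INum 0))) score_step,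
      iset ''c'' (IAdd (ivar ''c'') (INum 1))]"

lemma writes_reset [simp]:
  "int_writes reset = {''j'', ''k''}"
  "real_writes reset = {''A'', ''D'', ''g'', ''q'', ''w''}"
  by (auto simp: reset_def)

lemma writes_scan [simp]:
  "int_writes scan = {''p''}" "real_writes scan = {''g''}"
  by (auto simp: scan_def)

lemma writes_process_clause [simp]:
  "int_writes process_clause = {''j'', ''s'', ''e'', ''k'', ''p'', ''c''}"
  "real_writes process_clause = {''u'', ''v'', ''d'', ''r'', ''a'', ''b'', ''A'', ''D'', ''out'', ''q'', ''w'', ''g''}"
  by (auto simp: process_clause_def)

lemma runs_reset:
  assumes N: "ints s ''in'' 0 = int N" and n: "N + 2 \<le> n" and rn: "reals s ''n'' 0 = real N"
  shows "runs n reset s (\<lambda>s'. tables R N i 0 s' \<and> ints s' ''k'' 0 = 0 \<and> reals s' ''q'' 0 = 0 \<and>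
    reals s' ''w'' 0 = 1 / real N \<and> (\<forall>z. \<bar>z\<bar> \<le> int (Suc N) \<longrightarrow> reals s' ''g'' z = 1))"
proof -
  define I where "I = (\<lambda>m (s'::state). ints s' ''j'' 0 = int m \<and>
    (\<forall>j<m. reals s' ''A'' (int j) = 0 \<and> reals s' ''D'' (int j) = 0) \<and>
    (\<forall>z. \<bar>z\<bar> < int m \<longrightarrow> reals s' ''g'' z = 1))"
  let ?c = "block [RAssign ''A'' (ivar ''j'') (RNum 0), RAssign ''D'' (ivar ''j'') (RNum 0),
          RAssign ''g'' (ivar ''j'') (RNum 1), RAssign ''g'' (ISub (INum 0) (ivar ''j'')) (RNum 1),
          iset ''j'' (IAdd (ivar ''j'') (INum 1))]"
  let ?b = "ILess (ivar ''j'') (IAdd (ICell ''in'' (INum 0)) (INum 2))"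
  define s1 where "s1 = set_int ''j'' 0 0 s"
  have "runs n (While ?b ?c) s1 (\<lambda>s'. keeps ?c s1 s' \<and> I (N + 2) s')"
  proof (rule runs_While[of I _ "N + 2"])
    show "I 0 s1" by (simp add: I_def s1_def)
  next
    fix m s' assume m: "m < N + 2" and keeps: "keeps ?c s1 s'" and I: "I m s'"
    have "\<bar>z\<bar> < 1 + int m \<longleftrightarrow> \<bar>z\<bar> < int m \<or> z = int m \<or> z = - int m" for z by auto
    then have "runs n ?c s' (I (Suc m))"
      using I unfolding I_def block.simps
      by - ((rule runs_Seq)?, simp add: less_Suc_eq)+
    then show "bval ?b s' \<and> runs n ?c s' (I (Suc m))"
      using m I keeps N by (simp add: I_def s1_def keeps_def)
  next
    fix s' assume "keeps ?c s1 s'" "I (N + 2) s'"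
    then show "\<not> bval ?b s' \<and> keeps ?c s1 s' \<and> I (N + 2) s'"
      using N by (simp add: I_def s1_def keeps_def)
  qed (use n in simp)
  then show ?thesis
    unfolding reset_def block.simps
    apply -
    apply (rule runs_Seq, simp)
    apply (fold s1_def)
    apply (rule runs_Seq, erule runs_mono)
    by ((rule runs_Seq)?, simp add: keeps_def s1_def rn I_def tables_def)+
qed

lemma runs_scan:
  assumes p: "ints s ''p'' 0 = p" and n: "length L \<le> n"
    and L: "\<And>q. q < length L \<Longrightarrow> ints s ''in'' (p + int q) = L ! q \<and> L ! q \<noteq> 0"
    and z: "ints s ''in'' (p + int (length L)) = 0"
  shows "runs n scan s (\<lambda>s'. ints s' ''p'' 0 = p + int (length L) \<and>
    reals s' ''g'' = (\<lambda>z. if - z \<in> set L then 0 else reals s ''g'' z))"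
proof -
  define I where "I = (\<lambda>m (s'::state). ints s' ''p'' 0 = p + int m \<and>
    reals s' ''g'' = (\<lambda>z. if - z \<in> set (take m L) then 0 else reals s ''g'' z))"
  let ?c = "block [RAssign ''g'' (ISub (INum 0) (ICell ''in'' (ivar ''p''))) (RNum 0),
             iset ''p'' (IAdd (ivar ''p'') (INum 1))]"
  let ?b = "BNot (IEq (ICell ''in'' (ivar ''p'')) (INum 0))"
  show ?thesis unfolding scan_def
  proof (rule runs_While[of I _ "length L"])
    show "I 0 s" by (simp add: I_def p)
  next
    fix m s' assume m: "m < length L" and keeps: "keeps ?c s s'" and I: "I m s'"
    have [simp]: "ints s' ''in'' = ints s ''in''" using keeps by (simp add: keeps_def)
    have "runs n ?c s' (I (Suc m))"
      using I L[OF m] unfolding I_def block.simps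
      by - ((rule runs_Seq)?, auto simp: take_Suc_conv_app_nth[OF m] fun_eq_iff)+
    then show "bval ?b s' \<and> runs n ?c s' (I (Suc m))"
      using L[OF m] I by (simp add: I_def)
  next
    fix s' assume "keeps ?c s s'" "I (length L) s'"
    then show "\<not> bval ?b s' \<and> ints s' ''p'' 0 = p + int (length L) \<and>
       reals s' ''g'' = (\<lambda>z. if - z \<in> set L then 0 else reals s ''g'' z)"
      using z by (simp add: I_def keeps_def)
  qed fact
qed

lemma runs_process_clause:
  assumes N: "ints s ''in'' 0 = int N" "N \<ge> 1" and i: "ints s ''in'' 2 = int i" and n: "N + 2 \<le> n" "length L \<le> n"
    and p: "ints s ''p'' 0 = p" and c: "ints s ''c'' 0 = int c"
    and L: "\<And>q. q < length L \<Longrightarrow> ints s ''in'' (p + int q) = L ! q \<and> L ! q \<noteq> 0"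
    and z: "ints s ''in'' (p + int (length L)) = 0"
    and rn: "reals s ''n'' 0 = real N"
    and R: "R = ratio (point_in (ints s ''in'')) (transition_in (reals s ''in'')) (clause_guard L)"
  shows "runs n process_clause s (\<lambda>s'. ints s' ''p'' 0 = p + int (length L) + 1 \<and>
    ints s' ''c'' 0 = int (Suc c) \<and>
    reals s' ''out'' 0 = reals s ''out'' 0 + (\<Sum>k<N. path_score R N i k))"
  unfolding process_clause_def block.simps
proof (rule runs_Seq, rule runs_mono, rule runs_reset[OF N(1) n(1) rn, of R i], rule runs_Seq)
  fix s1 assume keeps1: "keeps reset s s1" and
    reset: "tables R N i 0 s1 \<and> ints s1 ''k'' 0 = 0 \<and> reals s1 ''q'' 0 = 0 \<and>
    reals s1 ''w'' 0 = 1 / real N \<and> (\<forall>z. \<bar>z\<bar> \<le> int (Suc N) \<longrightarrow> reals s1 ''g'' z = 1)"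
  let ?loop = "While (ILess (ivar ''k'') (ICell ''in'' (INum 0))) score_step"
  have scan: "runs n scan s1 (\<lambda>s'. ints s' ''p'' 0 = p + int (length L) \<and>
    reals s' ''g'' = (\<lambda>z. if - z \<in> set L then 0 else reals s1 ''g'' z))"
    by (rule runs_scan) (use keeps1 p n L z in \<open>simp_all add: keeps_def\<close>)
  show "runs n scan s1 (\<lambda>s2. runs n (Seq (iset ''p'' (IAdd (ivar ''p'') (INum 1)))
     (Seq ?loop (iset ''c'' (IAdd (ivar ''c'') (INum 1))))) s2
     (\<lambda>s'. ints s' ''p'' 0 = p + int (length L) + 1 \<and> ints s' ''c'' 0 = int (Suc c) \<and>
       reals s' ''out'' 0 = reals s ''out'' 0 + (\<Sum>k<N. path_score R N i k)))"
  proof (rule runs_mono, rule scan, rule runs_Seq, unfold runs_IAssign, rule runs_Seq)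
    fix s2 assume keeps2: "keeps scan s1 s2" and
      scan: "ints s2 ''p'' 0 = p + int (length L) \<and>
        reals s2 ''g'' = (\<lambda>z. if - z \<in> set L then 0 else reals s1 ''g'' z)"
    define s3 where "s3 = set_int ''p'' (ival (INum 0) s2) (ival (IAdd (ivar ''p'') (INum 1)) s2) s2"
    have s3: "ints s3 ''in'' = ints s ''in''" "reals s3 ''in'' = reals s ''in''"
      "ints s3 ''p'' 0 = p + int (length L) + 1" "ints s3 ''c'' 0 = int c"
      "reals s3 ''out'' = reals s ''out''" "reals s3 ''n'' 0 = real N" "reals s3 ''g'' = reals s2 ''g''"
      "reals s3 ''q'' 0 = 0" "reals s3 ''w'' 0 = 1 / real N" "ints s3 ''k'' 0 = 0" "tables R N i 0 s3"
      using keeps1 keeps2 scan reset c rn by (simp_all add: keeps_def s3_def tables_def)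
    have g: "guard_in (reals s3 ''g'') j = clause_guard L j" if "0 < j" "j \<le> Suc N" for j
      using that scan reset by (auto simp: s3 guard_in_def clause_guard_def fun_eq_iff)
    \<comment> \<open>A recursion started at \<open>j\<close> reads guards only strictly after
      \<open>j\<close>, so agreement on the positions 1 to \<open>N + 1\<close> is enough.\<close>
    have R': "R j e = ratio_of s3 j e" if "j < e" "e \<le> Suc N" for j e
    proof -
      have "forward x t {} (guard_in (reals s3 ''g'')) j (e - j) b = forward x t {} (clause_guard L) j (e - j) b"
        for x t b by (rule forward_cong) (use that g in auto)
      then show ?thesis by (simp add: R ratio_of_def ratio_def s3)
    qed
    define I where "I = (\<lambda>k (s'::state). tables R N i k s' \<and>
      ints s' ''k'' 0 = int k \<and> reals s' ''q'' 0 = real k \<and>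
      (k < N \<longrightarrow> reals s' ''w'' 0 = shapley_weight N k) \<and>
      reals s' ''out'' 0 = reals s ''out'' 0 + (\<Sum>l<k. path_score R N i l))"
    show "runs n ?loop s3 (\<lambda>s'. runs n (iset ''c'' (IAdd (ivar ''c'') (INum 1))) s'
       (\<lambda>s'. ints s' ''p'' 0 = p + int (length L) + 1 \<and> ints s' ''c'' 0 = int (Suc c) \<and>
       reals s' ''out'' 0 = reals s ''out'' 0 + (\<Sum>k<N. path_score R N i k)))"
    proof (rule runs_While[of I _ N])
      \<comment> \<open>The weight for \<open>k = 0\<close> is \<open>1 / N\<close>, the value
        stored by \<open>reset\<close>.\<close>
      have "fact N = real N * fact (N - 1)" using N(2) by (simp add: fact_reduce)
      then show "I 0 s3" using s3 N(2) by (simp add: I_def shapley_weight_def)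
    next
      fix k s' assume k: "k < N" and keeps: "keeps score_step s3 s'" and I: "I k s'"
      have [simp]: "ints s' ''in'' = ints s ''in''" "ratio_of s' = ratio_of s3"
        using keeps s3 ratio_of_cong[of s' s3] by (simp_all add: keeps_def)
      have "runs n score_step s' (\<lambda>s''. tables R N i (Suc k) s'' \<and>
        ints s'' ''k'' 0 = int (Suc k) \<and> reals s'' ''q'' 0 = real (Suc k) \<and>
        (Suc k < N \<longrightarrow> reals s'' ''w'' 0 = shapley_weight N (Suc k)) \<and>
        reals s'' ''out'' 0 = reals s' ''out'' 0 + path_score R N i k)"
        by (rule runs_score_step) (use k I N i n R' keeps s3 in \<open>auto simp: I_def keeps_def\<close>)
      then have "runs n score_step s' (I (Suc k))"
        by (rule runs_mono) (use I in \<open>simp add: I_def\<close>)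
      then show "bval (ILess (ivar ''k'') (ICell ''in'' (INum 0))) s' \<and> runs n score_step s' (I (Suc k))"
        using k I N by (simp add: I_def)
    next
      fix s' assume keeps: "keeps score_step s3 s'" and I: "I N s'"
      then show "\<not> bval (ILess (ivar ''k'') (ICell ''in'' (INum 0))) s' \<and>
        runs n (iset ''c'' (IAdd (ivar ''c'') (INum 1))) s'
       (\<lambda>s'. ints s' ''p'' 0 = p + int (length L) + 1 \<and> ints s' ''c'' 0 = int (Suc c) \<and>
       reals s' ''out'' 0 = reals s ''out'' 0 + (\<Sum>k<N. path_score R N i k))"
        using N s3 by (simp add: I_def keeps_def)
    qed (use n in simp)
  qed
qed

section \<open>The whole program\<close>

definition four_N :: "int \<Rightarrow> iexp" where
  "four_N r = IAdd (IAdd (IAdd (ICell ''in'' (INum 0)) (ICell ''in'' (INum 0)))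
                         (IAdd (ICell ''in'' (INum 0)) (ICell ''in'' (INum 0)))) (INum r)"

text \<open>Makes all transitions from \<open>N\<close> to the virtual position \<open>N + 1\<close> equal to 1.\<close>

definition prepare :: com where
  "prepare = block
     [RAssign ''in'' (four_N (- 2)) (RNum 1), RAssign ''in'' (four_N (- 1)) (RNum 1),
      RAssign ''in'' (four_N 0) (RNum 1), RAssign ''in'' (four_N 1) (RNum 1),
      iset ''p'' (IAdd (ICell ''in'' (INum 0)) (INum 3))]"

text \<open>The first loop obtains \<open>N\<close> as a real number by counting, the only available
  route from an integer to a real.\<close>

definition shap_program :: com where
  "shap_program = block
     [prepare,
      While (ILess (ivar ''j'') (ICell ''in'' (INum 0)))
        (Seq (rset ''n'' (RAdd (rvar ''n'') (RNum 1))) (iset ''j'' (IAdd (ivar ''j'') (INum 1)))),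
      While (ILess (ivar ''c'') (ICell ''in'' (INum 1))) process_clause]"

lemma runs_prepare:
  assumes N: "ints s ''in'' 0 = int N"
  shows "runs n prepare s (\<lambda>s'. ints s' ''p'' 0 = int N + 3 \<and>
    (\<forall>j a b. transition_in (reals s' ''in'') j a b =
       (if j = N then 1 else transition_in (reals s ''in'') j a b)))"
proof -
  have four: "ival (four_N r) s' = 4 * int N + r" if "ints s' ''in'' 0 = int N" for r s'
    using that by (simp add: four_N_def)
  \<comment> \<open>An encoded instance has \<open>4 * N - 2\<close> reals, so these are the four
    cells right after it and no parameter is overwritten.\<close>
  define v' where "v' = (reals s ''in'')(4 * int N - 2 := 1, 4 * int N - 1 := 1, 4 * int N := 1, 4 * int N + 1 := 1)"
  \<comment> \<open>The offsets range over -2 to 1, four distinct residues modulo 4, so the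
    addressing is injective.\<close>
  have addr: "4 * int j + (2 * of_bool a + of_bool b - 2) = 4 * int N + (2 * of_bool a' + of_bool b' - 2) \<longleftrightarrow>
     j = N \<and> a = a' \<and> b = b'" for j a b a' b'
    by (cases a; cases b; cases a'; cases b'; simp; presburger)
  have "transition_in v' j a b = (if j = N then 1 else transition_in (reals s ''in'') j a b)" for j a b
    using addr[of j a b False False] addr[of j a b False True] addr[of j a b True False] addr[of j a b True True]
    by (cases a; cases b; simp add: transition_in_def v'_def)
  then show ?thesis
    unfolding prepare_def block.simps v'_def
    by - ((rule runs_Seq)?, simp add: four N)+
qed

lemma runs_shap_program:
  assumes N: "ints s ''in'' 0 = int N" "N \<ge> 1" and m: "ints s ''in'' 1 = int (length Ls)"
    and i: "ints s ''in'' 2 = int i"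
    and n: "N + 2 \<le> n" "length Ls \<le> n" "\<And>L. L \<in> set Ls \<Longrightarrow> length L \<le> n"
    and nz: "\<And>L z. L \<in> set Ls \<Longrightarrow> z \<in> set L \<Longrightarrow> z \<noteq> 0"
    and tape: "\<And>q. q < length (concat (map (\<lambda>L. L @ [0]) Ls)) \<Longrightarrow>
      ints s ''in'' (int N + 3 + int q) = concat (map (\<lambda>L. L @ [0]) Ls) ! q"
    and zero: "ints s ''j'' 0 = 0" "ints s ''c'' 0 = 0" "reals s ''n'' 0 = 0" "reals s ''out'' 0 = 0"
    and x: "x = point_in (ints s ''in'')"
    and t: "\<And>j a b. t j a b = (if j = N then 1 else transition_in (reals s ''in'') j a b)"
  shows "runs n shap_program s (\<lambda>s'. result s' =
    (\<Sum>L\<leftarrow>Ls. \<Sum>k<N. path_score (ratio x t (clause_guard L)) N i k))"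
proof -
  let ?score = "\<lambda>L. \<Sum>k<N. path_score (ratio x t (clause_guard L)) N i k"
  let ?enc = "\<lambda>Ls. concat (map (\<lambda>L. L @ [0 :: int]) Ls)"
  let ?inc = "Seq (rset ''n'' (RAdd (rvar ''n'') (RNum 1))) (iset ''j'' (IAdd (ivar ''j'') (INum 1)))"
  let ?b1 = "ILess (ivar ''j'') (ICell ''in'' (INum 0))"
  let ?b2 = "ILess (ivar ''c'') (ICell ''in'' (INum 1))"
  have count: "runs n (While ?b1 ?inc) s1 (\<lambda>s'. reals s' ''n'' 0 = real N)"
    if "ints s1 ''in'' = ints s ''in''" "ints s1 ''j'' 0 = 0" "reals s1 ''n'' 0 = 0" for s1
  proof (rule runs_While[of "\<lambda>k s'. ints s' ''j'' 0 = int k \<and> reals s' ''n'' 0 = real k" _ N])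
    fix k s' assume "k < N" "keeps ?inc s1 s'" "ints s' ''j'' 0 = int k \<and> reals s' ''n'' 0 = real k"
    moreover from this have "ints s' ''in'' 0 = int N" using that N by (simp add: keeps_def)
    moreover have "runs n ?inc s' (\<lambda>s'. ints s' ''j'' 0 = int (Suc k) \<and> reals s' ''n'' 0 = real (Suc k))"
      by ((rule runs_Seq)?, simp add: calculation)+
    ultimately show "bval ?b1 s' \<and>
       runs n ?inc s' (\<lambda>s'. ints s' ''j'' 0 = int (Suc k) \<and> reals s' ''n'' 0 = real (Suc k))"
      by simp
  next
    fix s' assume "keeps ?inc s1 s'" "ints s' ''j'' 0 = int N \<and> reals s' ''n'' 0 = real N"
    moreover from this have "ints s' ''in'' 0 = int N" using that N by (simp add: keeps_def)
    ultimately show "\<not> bval ?b1 s' \<and> reals s' ''n'' 0 = real N" by simp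
  qed (use that n in auto)
  have main: "runs n (While ?b2 process_clause) s1 (\<lambda>s'. result s' = (\<Sum>L\<leftarrow>Ls. ?score L))"
    if s1: "ints s1 ''in'' = ints s ''in''" "ints s1 ''p'' 0 = int N + 3" "ints s1 ''c'' 0 = 0"
      "reals s1 ''n'' 0 = real N" "reals s1 ''out'' 0 = 0" "transition_in (reals s1 ''in'') = t" for s1
  proof -
    \<comment> \<open>The offset \<open>int N + 3\<close> skips three header cells and the
      \<open>N\<close> cells of the point; clauses are counted with their terminators.\<close>
    define I where "I = (\<lambda>c (s'::state). ints s' ''c'' 0 = int c \<and>
      ints s' ''p'' 0 = int N + 3 + int (length (?enc (take c Ls))) \<and>
      reals s' ''out'' 0 = (\<Sum>L\<leftarrow>take c Ls. ?score L))"
    show ?thesis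
    proof (rule runs_While[of I _ "length Ls"])
      show "I 0 s1" using s1 by (simp add: I_def)
    next
      fix c s' assume c: "c < length Ls" and keeps: "keeps process_clause s1 s'" and I: "I c s'"
      let ?L = "Ls ! c" and ?p = "int N + 3 + int (length (?enc (take c Ls)))"
      have L: "?L \<in> set Ls" using c by simp
      have s': "ints s' ''in'' = ints s ''in''" "reals s' ''n'' 0 = real N" "reals s' ''in'' = reals s1 ''in''"
        using keeps s1 by (simp_all add: keeps_def)
      have split: "?enc Ls = ?enc (take c Ls) @ (?L @ [0]) @ ?enc (drop (Suc c) Ls)"
        by (subst (1) id_take_nth_drop[OF c]) simp
      have cell: "ints s ''in'' (?p + int q) = (?L @ [0]) ! q" if "q < Suc (length ?L)" for q
        using tape[of "length (?enc (take c Ls)) + q"] that unfolding split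
        by (simp add: nth_append algebra_simps)
      have take: "take (Suc c) Ls = take c Ls @ [?L]" using c by (rule take_Suc_conv_app_nth)
      have "runs n process_clause s' (\<lambda>s''. ints s'' ''p'' 0 = ?p + int (length ?L) + 1 \<and>
         ints s'' ''c'' 0 = int (Suc c) \<and>
         reals s'' ''out'' 0 = reals s' ''out'' 0 + ?score ?L)"
      proof (rule runs_process_clause)
        show "ints s' ''in'' (?p + int q) = ?L ! q \<and> ?L ! q \<noteq> 0" if "q < length ?L" for q
          using cell[of q] nz[OF L] that by (simp add: s' nth_append)
        show "ints s' ''in'' (?p + int (length ?L)) = 0"
          using cell[of "length ?L"] by (simp add: s')
      qed (use I N i n(1) n(3)[OF L] s' s1 x in \<open>auto simp: I_def\<close>)
      then have "runs n process_clause s' (I (Suc c))"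
        by (rule runs_mono) (use I in \<open>simp add: I_def take\<close>)
      then show "bval ?b2 s' \<and> runs n process_clause s' (I (Suc c))"
        using I c m s' by (simp add: I_def)
    next
      fix s' assume "keeps process_clause s1 s'" "I (length Ls) s'"
      then show "\<not> bval ?b2 s' \<and> result s' = (\<Sum>L\<leftarrow>Ls. ?score L)"
        using m s1 by (simp add: I_def keeps_def result_def)
    qed (use n in simp)
  qed
  show ?thesis
    unfolding shap_program_def block.simps
  proof (rule runs_Seq, rule runs_mono, rule runs_prepare[OF N(1)], rule runs_Seq)
    fix s1 assume keeps: "keeps prepare s s1" and prep: "ints s1 ''p'' 0 = int N + 3 \<and>
      (\<forall>j a b. transition_in (reals s1 ''in'') j a b =
       (if j = N then 1 else transition_in (reals s ''in'') j a b))"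
    have t1: "transition_in (reals s1 ''in'') = t" using prep t by (auto simp: fun_eq_iff)
    have s1: "ints s1 ''in'' = ints s ''in''" "ints s1 ''j'' 0 = 0" "ints s1 ''c'' 0 = 0"
      "reals s1 ''n'' 0 = 0" "reals s1 ''out'' 0 = 0"
      using keeps zero by (simp_all add: keeps_def prepare_def)
    show "runs n (While ?b1 ?inc) s1 (\<lambda>s'. runs n (While ?b2 process_clause) s'
        (\<lambda>s'. result s' = (\<Sum>L\<leftarrow>Ls. ?score L)))"
      by (rule runs_mono, rule count, (fact s1)+, rule main)
        (use s1 t1 prep in \<open>simp_all add: keeps_def\<close>)
  qed
qed

section \<open>Instances in memory\<close>

lemma nth_concat_blocks:
  assumes "\<And>j. j < m \<Longrightarrow> length (f j) = 4" "j < m" "r < 4"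
  shows "concat (map f [0..<m]) ! (4 * j + r) = f j ! r"
  using assms
proof (induction m)
  case (Suc m)
  have len: "length (concat (map f [0..<m])) = 4 * m"
    using Suc.prems(1) by (simp add: length_concat comp_def sum_list_sum_nth)
  show ?case
    using Suc by (cases "j < m") (auto simp: nth_append len less_Suc_eq)
qed simp

text \<open>Each variable has two literals and none is repeated; this bounds the scan of a clause by
  the instance size.\<close>

lemma length_wf_clause:
  assumes "distinct C" "\<forall>l\<in>set C. lit_var l \<in> {1..N}"
  shows "length C \<le> 2 * N"
proof -
  have "set C \<subseteq> PosLit ` {1..N} \<union> NegLit ` {1..N}"
  proof
    fix l assume "l \<in> set C"
    with assms(2) have "lit_var l \<in> {1..N}" by blast
    then show "l \<in> PosLit ` {1..N} \<union> NegLit ` {1..N}" by (cases l) auto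
  qed
  then have "card (set C) \<le> card (PosLit ` {1..N} \<union> NegLit ` {1..N})" by (intro card_mono) auto
  also have "\<dots> \<le> card (PosLit ` {1..N}) + card (NegLit ` {1..N})" by (rule card_Un_le)
  also have "\<dots> \<le> N + N" by (intro add_mono order_trans[OF card_image_le]) auto
  finally show ?thesis using distinct_card[OF assms(1)] by simp
qed

theorem theorem4p2:
  shows "SHAP_dDNF_MARKOV \<in> FP"
proof -
  \<comment> \<open>With \<open>m\<close> clauses, the bound \<open>2 + 2 * (N + m)\<close> covers
    every loop: \<open>N + 2\<close> rows or cells, \<open>m\<close> clauses and up to
    \<open>2 * N\<close> literals in a clause.\<close>
  let ?p = "pcompose (cost shap_program) [:2, 2:]"
  have "\<exists>u s. exec shap_program (load (enc_shap a)) u s \<and>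
      u \<le> poly ?p (nvars (formula a) + length (clauses (formula a))) \<and>
      result s = SHAP (nvars (formula a)) (dnf_fun (formula a)) (point a) (index a)
                     (markov_pmf (nvars (formula a)) (distr a))"
    if \<Phi>: "disjoint_dnf (formula a)" and i: "index a \<in> {1..nvars (formula a)}"
      and M: "wf_markov (nvars (formula a)) (distr a)" for a
  proof -
    let ?\<Phi> = "formula a" and ?M = "distr a" and ?y = "point a"
    define N where "N = nvars ?\<Phi>"
    define Ls where "Ls = map (map enc_lit) (clauses ?\<Phi>)"
    define s where "s = load (enc_shap a)"
    define x where "x = point_in (ints s ''in'')"
    define t where "t = (\<lambda>j a b. if j = N then 1 else transition_in (reals s ''in'') j a b)"
    let ?n = "2 + 2 * (N + length (clauses ?\<Phi>))"
    have N: "N \<ge> 1" using i by (simp add: N_def)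
    have concat: "concat (map enc_clause (clauses ?\<Phi>)) = concat (map (\<lambda>L. L @ [0]) Ls)"
      by (simp add: Ls_def enc_clause_def[abs_def] comp_def)
    have ints: "ints s ''in'' (int q) = ([int N, int (length (clauses ?\<Phi>)), int (index a)]
        @ map (\<lambda>j. of_bool (?y j)) [1..<N + 1] @ concat (map (\<lambda>L. L @ [0]) Ls)) ! q"
      if "q < N + 3 + length (concat (map (\<lambda>L. L @ [0]) Ls))" for q
      using that by (simp add: s_def load_def enc_shap_def Let_def N_def concat)
    have head: "ints s ''in'' 0 = int N" "ints s ''in'' 1 = int (length (clauses ?\<Phi>))"
      "ints s ''in'' 2 = int (index a)"
      using ints[of 0] ints[of 1] ints[of 2] by simp_all
    have point: "ints s ''in'' (2 + int j) = of_bool (?y j)" if "j \<in> {1..N}" for j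
      using ints[of "2 + j"] that by (auto simp: nth_append nth_Cons' simp del: upt_Suc)
    have tape: "ints s ''in'' (int N + 3 + int q) = concat (map (\<lambda>L. L @ [0]) Ls) ! q"
      if "q < length (concat (map (\<lambda>L. L @ [0]) Ls))" for q
      using ints[of "N + 3 + q"] that by (auto simp: nth_append nth_Cons' algebra_simps simp del: upt_Suc)
    have wf: "distinct C" "\<forall>l\<in>set C. lit_var l \<in> {1..N}" if "C \<in> set (clauses ?\<Phi>)" for C
      using \<Phi> that by (auto simp: disjoint_dnf_def wf_dnf_def N_def)
    let ?f = "\<lambda>j. [transition ?M j False False, transition ?M j False True,
                    transition ?M j True False, transition ?M j True True]"
    have shift: "map ?f [1..<N] = map (\<lambda>j. ?f (Suc j)) [0..<N - 1]"
      by (rule nth_equalityI) auto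
    define B where "B = concat (map (\<lambda>j. ?f (Suc j)) [0..<N - 1])"
    have len: "length B = 4 * (N - 1)"
      by (simp add: B_def length_concat comp_def sum_list_triv)
    have "snd (enc_shap a) = [init ?M False, init ?M True] @ B"
      unfolding enc_shap_def Let_def N_def[symmetric] shift B_def by (rule snd_conv)
    then have reals: "reals s ''in'' = (\<lambda>k. if 0 \<le> k \<and> k < int (2 + 4 * (N - 1)) then
      ([init ?M False, init ?M True] @ B) ! nat k else 0)"
      by (simp add: s_def load_def len fun_eq_iff)
    have cell: "reals s ''in'' (int (2 + q)) = B ! q" if "q < 4 * (N - 1)" for q
      using that by (simp add: reals del: of_nat_add of_nat_Suc)
    have t0: "t 0 True b = init ?M b" for b
      using N by (cases b) (simp_all add: t_def transition_in_def reals)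
    have tj: "t j b c = transition ?M j b c" if "1 \<le> j" "j < N" for j b c
    proof -
      define r where "r = (2 * of_bool b + of_bool c :: nat)"
      have r: "r < 4" by (simp add: r_def)
      have "t j b c = reals s ''in'' (4 * int j + (2 * of_bool b + of_bool c - 2))"
        using that by (simp add: t_def transition_in_def)
      \<comment> \<open>The two initial probabilities come first, so the block of \<open>j\<close>
        starts at \<open>2 + 4 * (j - 1) = 4 * j - 2\<close>; this is the origin of the offset -2 in
        \<open>transition_in\<close>.\<close>
      also have "4 * int j + (2 * of_bool b + of_bool c - 2) = int (2 + (4 * (j - 1) + r))"
        using that by (simp add: r_def of_nat_diff)
      also have "reals s ''in'' \<dots> = B ! (4 * (j - 1) + r)"
        using that r by (subst cell) auto
      also have "\<dots> = ?f (Suc (j - 1)) ! r"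
        unfolding B_def by (rule nth_concat_blocks) (use that r in auto)
      also have "\<dots> = transition ?M j b c" using that by (cases b; cases c) (simp_all add: r_def)
      finally show ?thesis .
    qed
    have "runs ?n shap_program s (\<lambda>s'. result s' =
      (\<Sum>L\<leftarrow>Ls. \<Sum>k<N. path_score (ratio x t (clause_guard L)) N (index a) k))"
    proof (rule runs_shap_program[OF head(1) N _ head(3)])
      show "ints s ''in'' 1 = int (length Ls)" using head by (simp add: Ls_def)
      show "length L \<le> ?n" if "L \<in> set Ls" for L
        using that length_wf_clause[OF wf] by (fastforce simp: Ls_def)
      show "z \<noteq> 0" if L: "L \<in> set Ls" and z: "z \<in> set L" for L z
      proof -
        obtain C l where "C \<in> set (clauses ?\<Phi>)" "l \<in> set C" "z = enc_lit l" using L z by (auto simp: Ls_def)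
        moreover from this have "lit_var l \<ge> 1" using wf(2) by auto
        ultimately show ?thesis by (cases l) auto
      qed
    qed (use tape x_def t_def in \<open>auto simp: Ls_def s_def load_def\<close>)
    moreover have "SHAP N (dnf_fun ?\<Phi>) ?y (index a) (markov_pmf N ?M) =
      (\<Sum>L\<leftarrow>Ls. \<Sum>k<N. path_score (ratio x t (clause_guard L)) N (index a) k)"
    proof (subst SHAP_eq_path_scores[of ?\<Phi> N "index a" ?M x ?y t])
      show "x 0" using head i by (simp add: x_def point_in_def)
      show "x j = ?y j" if "j \<in> {1..N}" for j using point[OF that] by (simp add: x_def point_in_def)
    qed (use \<Phi> i M t0 tj in \<open>simp_all add: N_def Ls_def comp_def t_def\<close>)
    moreover have "poly ?p (N + length (clauses ?\<Phi>)) = poly (cost shap_program) ?n"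
      by (simp add: poly_pcompose mult.commute)
    ultimately show ?thesis
      unfolding runs_def s_def N_def[symmetric] by metis
  qed
  then show ?thesis
    unfolding FP_def SHAP_dDNF_MARKOV_def by (intro CollectI exI[of _ shap_program] exI[of _ ?p]) auto
qed

end
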